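(* Let $\mathcal{E}$ be an elementary topos that satisfies (NS) and such that $\mathrm{Dec}(\mathcal{E})$ is reflective in $\mathcal{E}$ (i.e. the inclusion $\mathrm{Dec}(\mathcal{E})\hookrightarrow\mathcal{E}$ has a left adjoint). Then (DQO) holds in $\mathcal{E}$.
   Context: An object $X$ of a topos $\mathcal{E}$ is decidable if its diagonal $X\rightarrowtail X\times X$ is a complemented subobject. $\mathrm{Dec}(\mathcal{E})$ is the full subcategory of $\mathcal{E}$ on the decidable objects. $2$ denotes $1+1$. (NS): any object of $\mathcal{E}$ is either initial or has a global element (an arrow from the terminal object $1$). (DQO): for every object $X$ there exists a unique (up to isomorphism under $X$) decidable quotient of $X$, i.e. an epimorphism $p_X:X\twoheadrightarrow \Pi X$ with $\Pi X$ decidable, along which any arrow $X\to 2$ factors uniquely. *)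

theory Defs
  imports Main
begin

section \<open>Categories\<close>

record ('o, 'a) cat =
  Obj :: "'o set"
  Arr :: "'a set"
  Dom :: "'a \<Rightarrow> 'o"
  Cod :: "'a \<Rightarrow> 'o"
  Id :: "'o \<Rightarrow> 'a"
  Comp :: "'a \<Rightarrow> 'a \<Rightarrow> 'a"  (infixl "\<cdot>\<index>" 70)

definition hom :: "('o, 'a, 'm) cat_scheme \<Rightarrow> 'o \<Rightarrow> 'o \<Rightarrow> 'a set" where
  "hom C A B = {f \<in> Arr C. Dom C f = A \<and> Cod C f = B}"

locale category =
  fixes C :: "('o, 'a) cat" (structure)
  assumes dom_obj: "f \<in> Arr C \<Longrightarrow> Dom C f \<in> Obj C"
    and cod_obj: "f \<in> Arr C \<Longrightarrow> Cod C f \<in> Obj C"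
    and id_hom: "X \<in> Obj C \<Longrightarrow> Id C X \<in> hom C X X"
    and comp_hom: "f \<in> hom C X Y \<Longrightarrow> g \<in> hom C Y Z \<Longrightarrow> g \<cdot> f \<in> hom C X Z"
    and id_left: "f \<in> hom C X Y \<Longrightarrow> Id C Y \<cdot> f = f"
    and id_right: "f \<in> hom C X Y \<Longrightarrow> f \<cdot> Id C X = f"
    and comp_assoc: "f \<in> hom C W X \<Longrightarrow> g \<in> hom C X Y \<Longrightarrow> h \<in> hom C Y Z
      \<Longrightarrow> (h \<cdot> g) \<cdot> f = h \<cdot> (g \<cdot> f)"

definition is_mono :: "('o, 'a) cat \<Rightarrow> 'a \<Rightarrow> bool" where
  "is_mono C m \<longleftrightarrow> m \<in> Arr C \<and>
     (\<forall>X. \<forall>f \<in> hom C X (Dom C m). \<forall>g \<in> hom C X (Dom C m).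
        m \<cdot>\<^bsub>C\<^esub> f = m \<cdot>\<^bsub>C\<^esub> g \<longrightarrow> f = g)"

definition is_epi :: "('o, 'a) cat \<Rightarrow> 'a \<Rightarrow> bool" where
  "is_epi C e \<longleftrightarrow> e \<in> Arr C \<and>
     (\<forall>Y. \<forall>f \<in> hom C (Cod C e) Y. \<forall>g \<in> hom C (Cod C e) Y.
        f \<cdot>\<^bsub>C\<^esub> e = g \<cdot>\<^bsub>C\<^esub> e \<longrightarrow> f = g)"

definition is_iso :: "('o, 'a) cat \<Rightarrow> 'a \<Rightarrow> bool" where
  "is_iso C f \<longleftrightarrow> f \<in> Arr C \<and>
     (\<exists>g \<in> hom C (Cod C f) (Dom C f).
        g \<cdot>\<^bsub>C\<^esub> f = Id C (Dom C f) \<and> f \<cdot>\<^bsub>C\<^esub> g = Id C (Cod C f))"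

section \<open>Functors, adjunctions and full subcategories\<close>

locale cat_functor = C: category C + D: category D
  for C :: "('o, 'a) cat" and D :: "('p, 'b) cat" +
  fixes F\<^sub>0 :: "'o \<Rightarrow> 'p" and F\<^sub>1 :: "'a \<Rightarrow> 'b"
  assumes map_obj: "X \<in> Obj C \<Longrightarrow> F\<^sub>0 X \<in> Obj D"
    and map_hom: "f \<in> hom C X Y \<Longrightarrow> F\<^sub>1 f \<in> hom D (F\<^sub>0 X) (F\<^sub>0 Y)"
    and map_id: "X \<in> Obj C \<Longrightarrow> F\<^sub>1 (Id C X) = Id D (F\<^sub>0 X)"
    and map_comp: "f \<in> hom C X Y \<Longrightarrow> g \<in> hom C Y Z
      \<Longrightarrow> F\<^sub>1 (g \<cdot>\<^bsub>C\<^esub> f) = F\<^sub>1 g \<cdot>\<^bsub>D\<^esub> F\<^sub>1 f"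

text \<open>\<open>L : C \<rightarrow> D\<close> is left adjoint to \<open>R : D \<rightarrow> C\<close>, via bijections
  \<open>\<phi> X Y : D(L X, Y) \<cong> C(X, R Y)\<close> natural in both variables.\<close>

locale adjunction = L: cat_functor C D L\<^sub>0 L\<^sub>1 + R: cat_functor D C R\<^sub>0 R\<^sub>1
  for C :: "('o, 'a) cat" and D :: "('p, 'b) cat" and L\<^sub>0 L\<^sub>1 R\<^sub>0 R\<^sub>1 +
  fixes \<phi> :: "'o \<Rightarrow> 'p \<Rightarrow> 'b \<Rightarrow> 'a"
  assumes hom_bij: "X \<in> Obj C \<Longrightarrow> Y \<in> Obj D
      \<Longrightarrow> bij_betw (\<phi> X Y) (hom D (L\<^sub>0 X) Y) (hom C X (R\<^sub>0 Y))"
    and hom_natural: "f \<in> hom C X' X \<Longrightarrow> g \<in> hom D Y Y' \<Longrightarrow> h \<in> hom D (L\<^sub>0 X) Y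
      \<Longrightarrow> \<phi> X' Y' (g \<cdot>\<^bsub>D\<^esub> h \<cdot>\<^bsub>D\<^esub> L\<^sub>1 f)
          = R\<^sub>1 g \<cdot>\<^bsub>C\<^esub> \<phi> X Y h \<cdot>\<^bsub>C\<^esub> f"

definition full_subcategory :: "('o, 'a) cat \<Rightarrow> ('o \<Rightarrow> bool) \<Rightarrow> ('o, 'a) cat" where
  "full_subcategory C P =
     C\<lparr>Obj := {X \<in> Obj C. P X}, Arr := {f \<in> Arr C. P (Dom C f) \<and> P (Cod C f)}\<rparr>"

lemma (in category) category_full_subcategory: "category (full_subcategory C P)"
proof -
  have "Id C X \<in> Arr C \<and> Dom C (Id C X) = X \<and> Cod C (Id C X) = X" if "X \<in> Obj C" for X
    using id_hom[OF that] by (simp add: hom_def)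
  moreover have "g \<cdot> f \<in> Arr C \<and> Dom C (g \<cdot> f) = Dom C f \<and> Cod C (g \<cdot> f) = Cod C g"
    if "f \<in> Arr C" "g \<in> Arr C" "Dom C g = Cod C f" for f g
    using comp_hom[of f "Dom C f" "Cod C f" g "Cod C g"] that by (simp add: hom_def)
  ultimately show ?thesis
    by unfold_locales
      (auto simp: full_subcategory_def hom_def dom_obj cod_obj id_left id_right comp_assoc)
qed

text \<open>A subcategory \<open>D\<close> of \<open>C\<close> is reflective if the inclusion functor, which is the identity
  on objects and on arrows, has a left adjoint.\<close>

definition reflective_in :: "('o, 'a) cat \<Rightarrow> ('o, 'a) cat \<Rightarrow> bool" where
  "reflective_in D C \<longleftrightarrow>
     (\<exists>L\<^sub>0 L\<^sub>1 \<phi>. adjunction C D L\<^sub>0 L\<^sub>1 (\<lambda>Y. Y) (\<lambda>g. g) \<phi>)"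

section \<open>Limits and colimits\<close>

definition is_terminal :: "('o, 'a) cat \<Rightarrow> 'o \<Rightarrow> bool" where
  "is_terminal C T \<longleftrightarrow> T \<in> Obj C \<and> (\<forall>X \<in> Obj C. \<exists>!f. f \<in> hom C X T)"

definition is_initial :: "('o, 'a) cat \<Rightarrow> 'o \<Rightarrow> bool" where
  "is_initial C I \<longleftrightarrow> I \<in> Obj C \<and> (\<forall>X \<in> Obj C. \<exists>!f. f \<in> hom C I X)"

definition is_product :: "('o, 'a) cat \<Rightarrow> 'o \<Rightarrow> 'o \<Rightarrow> 'o \<Rightarrow> 'a \<Rightarrow> 'a \<Rightarrow> bool" where
  "is_product C A B P p q \<longleftrightarrow> p \<in> hom C P A \<and> q \<in> hom C P B \<and>
     (\<forall>X. \<forall>f \<in> hom C X A. \<forall>g \<in> hom C X B.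
        \<exists>!h. h \<in> hom C X P \<and> p \<cdot>\<^bsub>C\<^esub> h = f \<and> q \<cdot>\<^bsub>C\<^esub> h = g)"

definition is_coproduct :: "('o, 'a) cat \<Rightarrow> 'o \<Rightarrow> 'o \<Rightarrow> 'o \<Rightarrow> 'a \<Rightarrow> 'a \<Rightarrow> bool" where
  "is_coproduct C A B S i j \<longleftrightarrow> i \<in> hom C A S \<and> j \<in> hom C B S \<and>
     (\<forall>Y. \<forall>f \<in> hom C A Y. \<forall>g \<in> hom C B Y.
        \<exists>!h. h \<in> hom C S Y \<and> h \<cdot>\<^bsub>C\<^esub> i = f \<and> h \<cdot>\<^bsub>C\<^esub> j = g)"

text \<open>\<open>is_pullback C f g p q\<close>: the square \<open>f \<cdot> p = g \<cdot> q\<close> is a pullback of the cospan \<open>(f, g)\<close>.\<close>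

definition is_pullback :: "('o, 'a) cat \<Rightarrow> 'a \<Rightarrow> 'a \<Rightarrow> 'a \<Rightarrow> 'a \<Rightarrow> bool" where
  "is_pullback C f g p q \<longleftrightarrow>
     f \<in> Arr C \<and> g \<in> Arr C \<and> Cod C f = Cod C g \<and>
     p \<in> hom C (Dom C p) (Dom C f) \<and> q \<in> hom C (Dom C p) (Dom C g) \<and>
     f \<cdot>\<^bsub>C\<^esub> p = g \<cdot>\<^bsub>C\<^esub> q \<and>
     (\<forall>X. \<forall>u \<in> hom C X (Dom C f). \<forall>v \<in> hom C X (Dom C g).
        f \<cdot>\<^bsub>C\<^esub> u = g \<cdot>\<^bsub>C\<^esub> v \<longrightarrow>
        (\<exists>!h. h \<in> hom C X (Dom C p) \<and> p \<cdot>\<^bsub>C\<^esub> h = u \<and> q \<cdot>\<^bsub>C\<^esub> h = v))"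

section \<open>Elementary toposes\<close>

text \<open>\<open>E\<close> with evaluation \<open>ev : E \<times> A \<rightarrow> B\<close> is an exponential \<open>B\<^sup>A\<close>, where \<open>(P, p, q)\<close> is the
  product \<open>E \<times> A\<close>. In the universal property \<open>(Q, r, s)\<close> is a product \<open>X \<times> A\<close>, and \<open>u\<close> is the
  arrow \<open>g \<times> A : X \<times> A \<rightarrow> E \<times> A\<close>.\<close>

definition is_exponential ::
  "('o, 'a) cat \<Rightarrow> 'o \<Rightarrow> 'o \<Rightarrow> 'o \<Rightarrow> 'o \<Rightarrow> 'a \<Rightarrow> 'a \<Rightarrow> 'a \<Rightarrow> bool" where
  "is_exponential C A B E P p q ev \<longleftrightarrow>
     is_product C E A P p q \<and> ev \<in> hom C P B \<and>
     (\<forall>X Q r s. is_product C X A Q r s \<longrightarrow>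
        (\<forall>f \<in> hom C Q B. \<exists>!g. g \<in> hom C X E \<and>
           (\<exists>u \<in> hom C Q P. p \<cdot>\<^bsub>C\<^esub> u = g \<cdot>\<^bsub>C\<^esub> r \<and> q \<cdot>\<^bsub>C\<^esub> u = s \<and>
              ev \<cdot>\<^bsub>C\<^esub> u = f)))"

definition is_subobject_classifier :: "('o, 'a) cat \<Rightarrow> 'o \<Rightarrow> 'o \<Rightarrow> 'a \<Rightarrow> bool" where
  "is_subobject_classifier C T \<Omega> t \<longleftrightarrow> is_terminal C T \<and> t \<in> hom C T \<Omega> \<and>
     (\<forall>m. is_mono C m \<longrightarrow>
        (\<exists>!\<chi>. \<chi> \<in> hom C (Cod C m) \<Omega> \<and> (\<exists>b. is_pullback C \<chi> t m b)))"

text \<open>Finite limits are given in the form of a terminal object and pullbacks. Finite colimits are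
  not assumed: they exist in every elementary topos.\<close>

locale elementary_topos = category C for C :: "('o, 'a) cat" +
  assumes has_terminal: "\<exists>T. is_terminal C T"
    and has_pullbacks: "f \<in> Arr C \<Longrightarrow> g \<in> Arr C \<Longrightarrow> Cod C f = Cod C g
      \<Longrightarrow> \<exists>p q. is_pullback C f g p q"
    and has_exponentials: "A \<in> Obj C \<Longrightarrow> B \<in> Obj C
      \<Longrightarrow> \<exists>E P p q ev. is_exponential C A B E P p q ev"
    and has_subobject_classifier: "\<exists>T \<Omega> t. is_subobject_classifier C T \<Omega> t"

section \<open>Decidable objects\<close>

definition is_subobject :: "('o, 'a) cat \<Rightarrow> 'o \<Rightarrow> 'a \<Rightarrow> bool" where
  "is_subobject C B m \<longleftrightarrow> is_mono C m \<and> Cod C m = B"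

definition sub_le :: "('o, 'a) cat \<Rightarrow> 'a \<Rightarrow> 'a \<Rightarrow> bool" where
  "sub_le C m n \<longleftrightarrow> (\<exists>k \<in> hom C (Dom C m) (Dom C n). n \<cdot>\<^bsub>C\<^esub> k = m)"

text \<open>\<open>n\<close> is a complement of \<open>m\<close> in the (pre)ordered set of subobjects of \<open>B\<close>: their meet is the
  least subobject and their join is the greatest one. Subobjects are represented by monomorphisms,
  so that meets and joins are only determined up to isomorphism; therefore the two conditions are
  phrased as ``every common lower bound is least'' and ``every common upper bound is greatest''.\<close>

definition is_complement :: "('o, 'a) cat \<Rightarrow> 'o \<Rightarrow> 'a \<Rightarrow> 'a \<Rightarrow> bool" where
  "is_complement C B m n \<longleftrightarrow> is_subobject C B m \<and> is_subobject C B n \<and>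
     (\<forall>u. is_subobject C B u \<and> sub_le C u m \<and> sub_le C u n
        \<longrightarrow> (\<forall>v. is_subobject C B v \<longrightarrow> sub_le C u v)) \<and>
     (\<forall>u. is_subobject C B u \<and> sub_le C m u \<and> sub_le C n u
        \<longrightarrow> (\<forall>v. is_subobject C B v \<longrightarrow> sub_le C v u))"

definition is_complemented :: "('o, 'a) cat \<Rightarrow> 'a \<Rightarrow> bool" where
  "is_complemented C m \<longleftrightarrow> (\<exists>n. is_complement C (Cod C m) m n)"

definition is_decidable :: "('o, 'a) cat \<Rightarrow> 'o \<Rightarrow> bool" where
  "is_decidable C X \<longleftrightarrow>
     (\<exists>P p q d. is_product C X X P p q \<and>
        d \<in> hom C X P \<and> p \<cdot>\<^bsub>C\<^esub> d = Id C X \<and> q \<cdot>\<^bsub>C\<^esub> d = Id C X \<and>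
        is_complemented C d)"

definition Dec :: "('o, 'a) cat \<Rightarrow> ('o, 'a) cat" where
  "Dec C = full_subcategory C (is_decidable C)"

section \<open>The conditions (NS) and (DQO)\<close>

definition NS :: "('o, 'a) cat \<Rightarrow> bool" where
  "NS C \<longleftrightarrow> (\<forall>X \<in> Obj C. is_initial C X \<or> (\<exists>T x. is_terminal C T \<and> x \<in> hom C T X))"

text \<open>\<open>T\<close> is (a choice of) the object \<open>2 = 1 + 1\<close>.\<close>

definition is_two :: "('o, 'a) cat \<Rightarrow> 'o \<Rightarrow> bool" where
  "is_two C T \<longleftrightarrow> (\<exists>U i j. is_terminal C U \<and> is_coproduct C U U T i j)"

text \<open>Since \<open>2\<close> is only determined up to isomorphism (and exists in every elementary topos), the
  factorization property is required for every choice of it.\<close>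

definition is_decidable_quotient :: "('o, 'a) cat \<Rightarrow> 'o \<Rightarrow> 'o \<Rightarrow> 'a \<Rightarrow> bool" where
  "is_decidable_quotient C X D p \<longleftrightarrow>
     p \<in> hom C X D \<and> is_epi C p \<and> is_decidable C D \<and>
     (\<forall>T. is_two C T \<longrightarrow>
        (\<forall>f \<in> hom C X T. \<exists>!g. g \<in> hom C D T \<and> g \<cdot>\<^bsub>C\<^esub> p = f))"

definition DQO :: "('o, 'a) cat \<Rightarrow> bool" where
  "DQO C \<longleftrightarrow> (\<forall>X \<in> Obj C. \<exists>D p. is_decidable_quotient C X D p \<and>
     (\<forall>D' p'. is_decidable_quotient C X D' p' \<longrightarrow>
        (\<exists>h \<in> hom C D D'. is_iso C h \<and> h \<cdot>\<^bsub>C\<^esub> p = p')))"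

end

theory Submission
  imports Defs
begin

text \<open>The unit \<open>\<eta> : X \<rightarrow> D\<close> of the reflection is epi, because subobjects of decidable objects are
  decidable, and arrows \<open>X \<rightarrow> 2\<close> factor uniquely through it, because \<open>2\<close> is decidable. Any other
  decidable quotient \<open>p' : X \<rightarrow> D'\<close> factors as \<open>h \<cdot> \<eta>\<close> with \<open>h\<close> epi. If \<open>h\<close> were not mono, the part of
  its kernel pair off the diagonal of \<open>D\<close> would not be initial, hence by (NS) would have a global
  element, i.e. \<open>h\<close> would identify two disjoint points of \<open>D\<close>. Some arrow \<open>D \<rightarrow> 2\<close> separates
  these, although it must factor through \<open>h\<close>. So \<open>h\<close> is mono and epi, hence iso.

  Subobjects are handled in Kripke-Joyal style: \<open>sub_le C x m\<close> for an arbitrary arrow \<open>x : X \<rightarrow> B\<close> is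
  read as \<open>x \<in> m\<close> for the generalized element \<open>x\<close>, and logical connectives are stable predicates on
  generalized elements.\<close>

section \<open>Generalized elements and subobjects\<close>

text \<open>The axioms supply a terminal object, pullbacks, exponentials and a classifier, while
  \<open>is_complement\<close> speaks only of the order on the subobjects of one object. Much of the
  proof bridges this gap: a least subobject must be shown to have an initial domain, joins must
  survive pullback, and a complementary pair must be a coproduct diagram, so that arrows into 2 can
  be defined by cases. Falsity, unions and 1 + 1 are built from the classifier \<Omega> and formulas
  that quantify over it, and new arrows arise by unique choice, as factorizations through the
  singleton map into a power object. On the side of (DQO), an arbitrary decidable quotient is tested
  on arrows into 2 only, whereas the reflection is universal for all decidable targets. (NS) closes
  this gap because equality with a global element of a decidable object is a complemented condition,
  and so is itself an arrow into 2.\<close>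

context category
begin

lemma homD:
  assumes "f \<in> hom C X Y"
  shows "f \<in> Arr C" "Dom C f = X" "Cod C f = Y" "X \<in> Obj C" "Y \<in> Obj C"
  using assms dom_obj cod_obj by (auto simp: hom_def)

lemma sub_le_iff:
  assumes "x \<in> hom C X B"
  shows "sub_le C x m \<longleftrightarrow> (\<exists>k \<in> hom C X (Dom C m). m \<cdot> k = x)"
  using homD[OF assms] by (simp add: sub_le_def)

lemma is_subobjectD:
  assumes "is_subobject C B m"
  shows "m \<in> hom C (Dom C m) B" "is_mono C m"
  using assms by (auto simp: is_subobject_def is_mono_def hom_def)

lemma is_monoI:
  assumes "m \<in> hom C M B"
    and "\<And>X f g. f \<in> hom C X M \<Longrightarrow> g \<in> hom C X M \<Longrightarrow> m \<cdot> f = m \<cdot> g \<Longrightarrow> f = g"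
  shows "is_mono C m"
  using assms homD[OF assms(1)] by (auto simp: is_mono_def)

lemma is_subobjectI:
  assumes "m \<in> hom C M B"
    and "\<And>X f g. f \<in> hom C X M \<Longrightarrow> g \<in> hom C X M \<Longrightarrow> m \<cdot> f = m \<cdot> g \<Longrightarrow> f = g"
  shows "is_subobject C B m"
  using is_monoI[OF assms] homD[OF assms(1)] by (simp add: is_subobject_def)

lemma mono_cancel:
  assumes "is_mono C m" "m \<in> hom C M B" "f \<in> hom C X M" "g \<in> hom C X M" "m \<cdot> f = m \<cdot> g"
  shows "f = g"
  using assms homD[OF assms(2)] by (auto simp: is_mono_def)

lemma epi_cancel:
  assumes "is_epi C e" "e \<in> hom C X D" "f \<in> hom C D Y" "g \<in> hom C D Y" "f \<cdot> e = g \<cdot> e"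
  shows "f = g"
  using assms homD[OF assms(2)] by (auto simp: is_epi_def)

lemma sub_le_comp:
  assumes "m \<in> hom C M B" "x \<in> hom C X B" "sub_le C x m" "y \<in> hom C Y X"
  shows "sub_le C (x \<cdot> y) m"
proof -
  obtain k where k: "k \<in> hom C X M" "m \<cdot> k = x"
    using assms sub_le_iff[OF assms(2)] homD[OF assms(1)] by auto
  then have "m \<cdot> (k \<cdot> y) = x \<cdot> y" "k \<cdot> y \<in> hom C Y M"
    using comp_assoc[OF assms(4) k(1) assms(1)] comp_hom[OF assms(4) k(1)] by auto
  then show ?thesis
    using sub_le_iff[OF comp_hom[OF assms(4,2)]] homD[OF assms(1)] by auto
qed

lemma sub_le_trans:
  assumes "x \<in> hom C X B" "m \<in> hom C M B" "n \<in> hom C N B" "sub_le C x m" "sub_le C m n"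
  shows "sub_le C x n"
proof -
  obtain k where "k \<in> hom C X M" "m \<cdot> k = x"
    using assms sub_le_iff[OF assms(1)] homD[OF assms(2)] by auto
  then show ?thesis
    using sub_le_comp[OF assms(3,2,5)] by auto
qed

lemma sub_le_refl:
  assumes "m \<in> hom C M B"
  shows "sub_le C m m"
  using assms homD[OF assms] id_right[OF assms] id_hom[of M] by (auto simp: sub_le_def)

lemma sub_le_comp_left:
  assumes "m \<in> hom C M B" "k \<in> hom C X M"
  shows "sub_le C (m \<cdot> k) m"
  using sub_le_comp[OF assms(1,1) sub_le_refl[OF assms(1)] assms(2)] .

lemma sub_le_if_id:
  assumes "m \<in> hom C M B" "sub_le C (Id C B) m" "x \<in> hom C X B"
  shows "sub_le C x m"
  using sub_le_comp[OF assms(1) id_hom assms(2,3)] id_left[OF assms(3)] homD[OF assms(3)] by auto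

lemma mono_section_iso:
  assumes m: "is_subobject C B m" and id: "sub_le C (Id C B) m"
  shows "is_iso C m"
proof -
  note mh = is_subobjectD(1)[OF m]
  have B: "B \<in> Obj C" and M: "Dom C m \<in> Obj C"
    using homD[OF mh] by auto
  obtain k where k: "k \<in> hom C B (Dom C m)" "m \<cdot> k = Id C B"
    using id sub_le_iff[OF id_hom[OF B]] by auto
  have "m \<cdot> (k \<cdot> m) = m \<cdot> Id C (Dom C m)"
    using comp_assoc[OF mh k(1) mh] k(2) id_left[OF mh] id_right[OF mh] by simp
  then have "k \<cdot> m = Id C (Dom C m)"
    using mono_cancel[OF is_subobjectD(2)[OF m] mh comp_hom[OF mh k(1)] id_hom[OF M]] by simp
  then show ?thesis
    using k homD[OF mh] by (auto simp: is_iso_def)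
qed

section \<open>Products, terminal objects and the diagonal\<close>

lemma product_pair:
  assumes "is_product C A B P p q" "f \<in> hom C X A" "g \<in> hom C X B"
  obtains h where "h \<in> hom C X P" "p \<cdot> h = f" "q \<cdot> h = g"
  using assms unfolding is_product_def by blast

lemma product_ext:
  assumes P: "is_product C A B P p q" and f: "f \<in> hom C X P" and g: "g \<in> hom C X P"
    and "p \<cdot> f = p \<cdot> g" "q \<cdot> f = q \<cdot> g"
  shows "f = g"
proof -
  have "p \<in> hom C P A" "q \<in> hom C P B"
    using P by (auto simp: is_product_def)
  then have "p \<cdot> g \<in> hom C X A" "q \<cdot> g \<in> hom C X B"
    using comp_hom g by auto
  then have "\<exists>!h. h \<in> hom C X P \<and> p \<cdot> h = p \<cdot> g \<and> q \<cdot> h = q \<cdot> g"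
    using P unfolding is_product_def by blast
  then show ?thesis
    using assms by blast
qed

lemma productD:
  assumes "is_product C A B P p q"
  shows "p \<in> hom C P A" "q \<in> hom C P B" "A \<in> Obj C" "B \<in> Obj C" "P \<in> Obj C"
  using assms homD by (auto simp: is_product_def)

lemma is_terminalD:
  assumes "is_terminal C T" "X \<in> Obj C"
  obtains f where "f \<in> hom C X T"
  using assms unfolding is_terminal_def by blast

lemma terminal_unique:
  assumes "is_terminal C T" "f \<in> hom C X T" "g \<in> hom C X T"
  shows "f = g"
  using assms homD(4)[OF assms(2)] unfolding is_terminal_def by blast

lemma point_is_subobject:
  assumes "is_terminal C T" "t \<in> hom C T B"
  shows "is_subobject C B t"
  using terminal_unique[OF assms(1)] assms(2) by (intro is_subobjectI) auto

lemma subobject_comp: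
  assumes m: "is_subobject C B m" and n: "is_subobject C (Dom C m) n"
  shows "is_subobject C B (m \<cdot> n)"
proof (rule is_subobjectI)
  note mh = is_subobjectD(1)[OF m] and nh = is_subobjectD(1)[OF n]
  show "m \<cdot> n \<in> hom C (Dom C n) B"
    using comp_hom[OF nh mh] .
  fix X f g assume f: "f \<in> hom C X (Dom C n)" and g: "g \<in> hom C X (Dom C n)"
    and "m \<cdot> n \<cdot> f = m \<cdot> n \<cdot> g"
  then have "m \<cdot> (n \<cdot> f) = m \<cdot> (n \<cdot> g)"
    using comp_assoc[OF _ nh mh] by metis
  then have "n \<cdot> f = n \<cdot> g"
    using mono_cancel[OF is_subobjectD(2)[OF m] mh comp_hom[OF f nh] comp_hom[OF g nh]] by simp
  then show "f = g"
    using mono_cancel[OF is_subobjectD(2)[OF n] nh f g] by simp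
qed

text \<open>Membership in the diagonal is equality of the two coordinates; this turns decidability
  of an object into excluded middle for equality of its generalized elements.\<close>

lemma diagonal:
  assumes P: "is_product C Y Y P p q"
    and d: "d \<in> hom C Y P" "p \<cdot> d = Id C Y" "q \<cdot> d = Id C Y"
  shows "is_subobject C P d"
    and "w \<in> hom C X P \<Longrightarrow> sub_le C w d \<longleftrightarrow> p \<cdot> w = q \<cdot> w"
proof -
  note p = productD(1)[OF P] and q = productD(2)[OF P]
  have pd: "p \<cdot> (d \<cdot> k) = k" "q \<cdot> (d \<cdot> k) = k" if "k \<in> hom C X Y" for X k
    using comp_assoc[OF that d(1) p] comp_assoc[OF that d(1) q] d id_left[OF that] by auto
  show "is_subobject C P d"
    by (rule is_subobjectI[OF d(1)]) (metis pd(1))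
  assume w: "w \<in> hom C X P"
  have pw: "p \<cdot> w \<in> hom C X Y"
    using comp_hom[OF w p] .
  show "sub_le C w d \<longleftrightarrow> p \<cdot> w = q \<cdot> w"
  proof
    assume "sub_le C w d"
    then show "p \<cdot> w = q \<cdot> w"
      using sub_le_iff[OF w] homD[OF d(1)] pd by metis
  next
    assume "p \<cdot> w = q \<cdot> w"
    then have "d \<cdot> (p \<cdot> w) = w"
      using product_ext[OF P comp_hom[OF pw d(1)] w] pd[OF pw] by simp
    then show "sub_le C w d"
      using sub_le_comp_left[OF d(1) pw] by simp
  qed
qed

text \<open>A formula with an extension. It takes only the arrow \<open>x\<close> as argument,
  because the stage can be read off as \<open>Dom C x\<close>; stability under precomposition
  follows from factoring through \<open>m\<close>.\<close>

definition representable :: "'o \<Rightarrow> ('a \<Rightarrow> bool) \<Rightarrow> bool" where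
  "representable B \<Phi> \<longleftrightarrow>
     (\<exists>m. is_subobject C B m \<and> (\<forall>X. \<forall>x \<in> hom C X B. sub_le C x m \<longleftrightarrow> \<Phi> x))"

lemma representableE:
  assumes "representable B \<Phi>"
  obtains m where "is_subobject C B m" "m \<in> hom C (Dom C m) B"
    "\<And>X x. x \<in> hom C X B \<Longrightarrow> sub_le C x m \<longleftrightarrow> \<Phi> x"
  using assms is_subobjectD unfolding representable_def by blast

lemma representable_cong:
  assumes "representable B \<Phi>" "\<And>X x. x \<in> hom C X B \<Longrightarrow> \<Phi> x \<longleftrightarrow> \<Psi> x"
  shows "representable B \<Psi>"
  using assms unfolding representable_def by blast

lemma representable_subobject:
  "is_subobject C B m \<Longrightarrow> representable B (\<lambda>x. sub_le C x m)"
  unfolding representable_def by blast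

end

section \<open>Closure of representable predicates under substitution, conjunction and
  equality\<close>

locale topos = elementary_topos C for C :: "('o, 'a) cat" (structure)
begin

lemma representable_pullback:
  assumes f: "f \<in> hom C B B'" and \<Phi>: "representable B' \<Phi>"
  shows "representable B (\<lambda>x. \<Phi> (f \<cdot> x))"
proof -
  obtain m where m: "is_subobject C B' m" "m \<in> hom C (Dom C m) B'"
      and m_iff: "\<And>X x. x \<in> hom C X B' \<Longrightarrow> sub_le C x m \<longleftrightarrow> \<Phi> x"
    using representableE[OF \<Phi>] by blast
  obtain p q where pb: "is_pullback C f m p q"
    using has_pullbacks homD[OF f] homD[OF m(2)] by metis
  let ?P = "Dom C p"
  have p: "p \<in> hom C ?P B" and q: "q \<in> hom C ?P (Dom C m)" and sq: "f \<cdot> p = m \<cdot> q"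
    using pb homD[OF f] by (auto simp: is_pullback_def)
  have univ: "\<exists>!h. h \<in> hom C X ?P \<and> p \<cdot> h = u \<and> q \<cdot> h = v"
    if "u \<in> hom C X B" "v \<in> hom C X (Dom C m)" "f \<cdot> u = m \<cdot> v" for X u v
    using pb that homD[OF f] unfolding is_pullback_def by blast
  have "is_subobject C B p"
  proof (rule is_subobjectI[OF p])
    fix X g h assume g: "g \<in> hom C X ?P" and h: "h \<in> hom C X ?P" and eq: "p \<cdot> g = p \<cdot> h"
    have eqs: "m \<cdot> (q \<cdot> k) = f \<cdot> (p \<cdot> k)" if "k \<in> hom C X ?P" for k
      using comp_assoc[OF that q m(2)] comp_assoc[OF that p f] sq by simp
    then have "m \<cdot> (q \<cdot> g) = m \<cdot> (q \<cdot> h)"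
      using g h eq by simp
    then have "q \<cdot> g = q \<cdot> h"
      using mono_cancel[OF is_subobjectD(2)[OF m(1)] m(2)] comp_hom g h q by blast
    then show "g = h"
      using univ[OF comp_hom[OF g p] comp_hom[OF g q]] eqs[OF g] eq g h by auto
  qed
  moreover have "sub_le C x p \<longleftrightarrow> \<Phi> (f \<cdot> x)" if x: "x \<in> hom C X B" for X x
  proof
    assume "sub_le C x p"
    then obtain k where k: "k \<in> hom C X ?P" "p \<cdot> k = x"
      using sub_le_iff[OF x] by auto
    then have "m \<cdot> (q \<cdot> k) = f \<cdot> x"
      using comp_assoc[OF k(1) q m(2)] comp_assoc[OF k(1) p f] sq by simp
    then show "\<Phi> (f \<cdot> x)"
      using sub_le_comp_left[OF m(2) comp_hom[OF k(1) q]] m_iff[OF comp_hom[OF x f]] by simp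
  next
    assume "\<Phi> (f \<cdot> x)"
    then obtain k where "k \<in> hom C X (Dom C m)" "m \<cdot> k = f \<cdot> x"
      using m_iff[OF comp_hom[OF x f]] sub_le_iff[OF comp_hom[OF x f]] by auto
    then show "sub_le C x p"
      using univ[OF x] sub_le_iff[OF x] by metis
  qed
  ultimately show ?thesis
    unfolding representable_def by blast
qed

lemma representable_and:
  assumes "representable B \<Phi>" "representable B \<Psi>"
  shows "representable B (\<lambda>x. \<Phi> x \<and> \<Psi> x)"
proof -
  obtain m where m: "is_subobject C B m" "m \<in> hom C (Dom C m) B"
      and m_iff: "\<And>X x. x \<in> hom C X B \<Longrightarrow> sub_le C x m \<longleftrightarrow> \<Phi> x"
    using representableE[OF assms(1)] by blast
  \<comment> \<open>The intersection is formed as a composite: \<open>\<Psi>\<close> is restricted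
    along \<open>m\<close>, and the subobject \<open>n\<close> of \<open>Dom C m\<close> found there
    is carried back to \<open>B\<close> by \<open>m\<close>.\<close>
  obtain n where n: "is_subobject C (Dom C m) n" "n \<in> hom C (Dom C n) (Dom C m)"
      and n_iff: "\<And>X x. x \<in> hom C X (Dom C m) \<Longrightarrow> sub_le C x n \<longleftrightarrow> \<Psi> (m \<cdot> x)"
    using representableE[OF representable_pullback[OF m(2) assms(2)]] by blast
  have mn: "m \<cdot> n \<in> hom C (Dom C n) B"
    using comp_hom m n by blast
  have "is_subobject C B (m \<cdot> n)"
    using subobject_comp[OF m(1) n(1)] .
  moreover have "sub_le C x (m \<cdot> n) \<longleftrightarrow> \<Phi> x \<and> \<Psi> x" if x: "x \<in> hom C X B" for X x
  proof
    assume "sub_le C x (m \<cdot> n)"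
    then obtain k where k: "k \<in> hom C X (Dom C n)" "m \<cdot> n \<cdot> k = x"
      using sub_le_iff[OF x] homD[OF mn] by auto
    have eq: "m \<cdot> (n \<cdot> k) = x"
      using comp_assoc[OF k(1) n(2) m(2)] k(2) by simp
    then show "\<Phi> x \<and> \<Psi> x"
      using sub_le_comp_left[OF m(2) comp_hom[OF k(1) n(2)]] m_iff[OF x]
        sub_le_comp_left[OF n(2) k(1)] n_iff[OF comp_hom[OF k(1) n(2)]] by simp
  next
    assume "\<Phi> x \<and> \<Psi> x"
    then obtain k where k: "k \<in> hom C X (Dom C m)" "m \<cdot> k = x"
      using m_iff[OF x] sub_le_iff[OF x] by auto
    then obtain l where l: "l \<in> hom C X (Dom C n)" "n \<cdot> l = k"
      using n_iff[OF k(1)] \<open>\<Phi> x \<and> \<Psi> x\<close> sub_le_iff[OF k(1)] by auto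
    then have "m \<cdot> n \<cdot> l = x"
      using comp_assoc[OF l(1) n(2) m(2)] k(2) by simp
    then show "sub_le C x (m \<cdot> n)"
      using sub_le_iff[OF x] homD[OF mn] l(1) by auto
  qed
  ultimately show ?thesis
    unfolding representable_def by blast
qed

lemma product_exists:
  assumes A: "A \<in> Obj C" and B: "B \<in> Obj C"
  obtains P p q where "is_product C A B P p q"
proof -
  obtain T where T: "is_terminal C T"
    using has_terminal by blast
  obtain f where f: "f \<in> hom C A T"
    using is_terminalD[OF T A] by blast
  obtain g where g: "g \<in> hom C B T"
    using is_terminalD[OF T B] by blast
  obtain p q where pb: "is_pullback C f g p q"
    using has_pullbacks homD[OF f] homD[OF g] by metis
  have "\<exists>!h. h \<in> hom C X (Dom C p) \<and> p \<cdot> h = u \<and> q \<cdot> h = v"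
    if "u \<in> hom C X A" "v \<in> hom C X B" for X u v
  proof -
    have "f \<cdot> u = g \<cdot> v"
      using terminal_unique[OF T comp_hom[OF that(1) f] comp_hom[OF that(2) g]] .
    then show ?thesis
      using pb that unfolding is_pullback_def homD(2)[OF f] homD(2)[OF g] by blast
  qed
  then have "is_product C A B (Dom C p) p q"
    using pb homD[OF f] homD[OF g] by (auto simp: is_product_def is_pullback_def)
  then show ?thesis
    using that by blast
qed

text \<open>The equalizer of \<open>f\<close> and \<open>g\<close>, obtained as the preimage of the
  diagonal of \<open>Y\<close> under the pair \<open>h = (f, g)\<close>.\<close>

lemma representable_eq:
  assumes f: "f \<in> hom C B Y" and g: "g \<in> hom C B Y"
  shows "representable B (\<lambda>x. f \<cdot> x = g \<cdot> x)"
proof -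
  have Y: "Y \<in> Obj C"
    using homD[OF f] by simp
  obtain P p q where P: "is_product C Y Y P p q"
    using product_exists[OF Y Y] by blast
  note p = productD(1)[OF P] and q = productD(2)[OF P]
  obtain d where d: "d \<in> hom C Y P" "p \<cdot> d = Id C Y" "q \<cdot> d = Id C Y"
    using product_pair[OF P id_hom[OF Y] id_hom[OF Y]] by blast
  obtain h where h: "h \<in> hom C B P" "p \<cdot> h = f" "q \<cdot> h = g"
    using product_pair[OF P f g] by blast
  have "representable B (\<lambda>x. sub_le C (h \<cdot> x) d)"
    using representable_pullback[OF h(1) representable_subobject[OF diagonal(1)[OF P d]]] .
  moreover have "sub_le C (h \<cdot> x) d \<longleftrightarrow> f \<cdot> x = g \<cdot> x" if x: "x \<in> hom C X B" for X x
    using diagonal(2)[OF P d comp_hom[OF x h(1)]] comp_assoc[OF x h(1) p] comp_assoc[OF x h(1) q] h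
    by simp
  ultimately show ?thesis
    by (rule representable_cong)
qed

lemma representable_True:
  assumes "B \<in> Obj C"
  shows "representable B (\<lambda>_. True)"
proof (rule representable_cong)
  show "representable B (\<lambda>x. Id C B \<cdot> x = Id C B \<cdot> x)"
    using representable_eq[OF id_hom[OF assms] id_hom[OF assms]] .
qed simp

section \<open>The subobject classifier and power objects\<close>

lemma classifier_exists:
  obtains T \<Omega> t where "is_subobject_classifier C T \<Omega> t" "is_terminal C T" "t \<in> hom C T \<Omega>"
  using has_subobject_classifier unfolding is_subobject_classifier_def by blast

lemma classifierD:
  assumes "is_subobject_classifier C T \<Omega> t"
  shows "is_terminal C T" "t \<in> hom C T \<Omega>" "is_subobject C \<Omega> t" "\<Omega> \<in> Obj C"
  using assms point_is_subobject homD unfolding is_subobject_classifier_def by auto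

text \<open>The point \<open>t\<close> is the truth value true, so
  \<open>sub_le C (\<chi> \<cdot> x) t\<close> reads: the formula with characteristic arrow \<chi>
  holds at \<open>x\<close>.\<close>

lemma classify:
  assumes cl: "is_subobject_classifier C T \<Omega> t" and \<Phi>: "representable B \<Phi>"
  obtains \<chi> where "\<chi> \<in> hom C B \<Omega>"
    "\<And>X x. x \<in> hom C X B \<Longrightarrow> sub_le C (\<chi> \<cdot> x) t \<longleftrightarrow> \<Phi> x"
proof -
  note t = classifierD(2)[OF cl]
  obtain m where m: "is_subobject C B m" "m \<in> hom C (Dom C m) B"
      and m_iff: "\<And>X x. x \<in> hom C X B \<Longrightarrow> sub_le C x m \<longleftrightarrow> \<Phi> x"
    using representableE[OF \<Phi>] by blast
  have "is_mono C m" "Cod C m = B"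
    using m by (simp_all add: is_subobject_def)
  then obtain \<chi> b where \<chi>: "\<chi> \<in> hom C B \<Omega>" and pb: "is_pullback C \<chi> t m b"
    using cl unfolding is_subobject_classifier_def by blast
  have b: "b \<in> hom C (Dom C m) T" and sq: "\<chi> \<cdot> m = t \<cdot> b"
    using pb homD[OF t] by (auto simp: is_pullback_def)
  have "sub_le C (\<chi> \<cdot> x) t \<longleftrightarrow> \<Phi> x" if x: "x \<in> hom C X B" for X x
  proof
    assume "sub_le C (\<chi> \<cdot> x) t"
    then obtain k where k: "k \<in> hom C X T" "\<chi> \<cdot> x = t \<cdot> k"
      using sub_le_iff[OF comp_hom[OF x \<chi>]] homD[OF t] by auto
    have "\<forall>X. \<forall>u \<in> hom C X B. \<forall>v \<in> hom C X T. \<chi> \<cdot> u = t \<cdot> v \<longrightarrow>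
        (\<exists>h. h \<in> hom C X (Dom C m) \<and> m \<cdot> h = u)"
      using pb homD(2)[OF t] homD(2)[OF \<chi>] unfolding is_pullback_def by metis
    then have "sub_le C x m"
      using k x sub_le_iff[OF x] by blast
    then show "\<Phi> x"
      using m_iff[OF x] by simp
  next
    assume "\<Phi> x"
    then obtain k where k: "k \<in> hom C X (Dom C m)" "m \<cdot> k = x"
      using m_iff[OF x] sub_le_iff[OF x] by auto
    have "\<chi> \<cdot> x = t \<cdot> (b \<cdot> k)"
      using comp_assoc[OF k(1) m(2) \<chi>] comp_assoc[OF k(1) b t] sq k(2) by simp
    then show "sub_le C (\<chi> \<cdot> x) t"
      using sub_le_comp_left[OF t comp_hom[OF k(1) b]] by simp
  qed
  then show ?thesis
    using that \<chi> by blast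
qed

text \<open>Propositional extensionality. The subobject \<open>m\<close> on which \<alpha> is true
  is a pullback of \<open>t\<close> along \<alpha> and along \<beta>, so uniqueness of the
  classifying arrow identifies the two.\<close>

lemma classifier_ext:
  assumes cl: "is_subobject_classifier C T \<Omega> t"
    and \<alpha>: "\<alpha> \<in> hom C X \<Omega>" and \<beta>: "\<beta> \<in> hom C X \<Omega>"
    and iff: "\<And>Y y. y \<in> hom C Y X \<Longrightarrow> sub_le C (\<alpha> \<cdot> y) t \<longleftrightarrow> sub_le C (\<beta> \<cdot> y) t"
  shows "\<alpha> = \<beta>"
proof -
  note T = classifierD(1)[OF cl] and t = classifierD(2)[OF cl] and ts = classifierD(3)[OF cl]
  obtain m where m: "is_subobject C X m" "m \<in> hom C (Dom C m) X"
      and m_iff: "\<And>Y y. y \<in> hom C Y X \<Longrightarrow> sub_le C y m \<longleftrightarrow> sub_le C (\<alpha> \<cdot> y) t"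
    using representableE[OF representable_pullback[OF \<alpha> representable_subobject[OF ts]]] by blast
  obtain b where b: "b \<in> hom C (Dom C m) T"
    using is_terminalD[OF T homD(4)[OF m(2)]] by blast
  have "is_pullback C \<gamma> t m b"
    if \<gamma>: "\<gamma> \<in> hom C X \<Omega>" and \<gamma>_iff: "\<And>Y y. y \<in> hom C Y X \<Longrightarrow> sub_le C y m \<longleftrightarrow> sub_le C (\<gamma> \<cdot> y) t"
    for \<gamma>
  proof -
    have \<gamma>m: "\<gamma> \<cdot> m \<in> hom C (Dom C m) \<Omega>"
      using comp_hom \<gamma> m(2) by blast
    have "sub_le C (\<gamma> \<cdot> m) t"
      using \<gamma>_iff[OF m(2)] sub_le_refl[OF m(2)] by simp
    then have "\<gamma> \<cdot> m = t \<cdot> b"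
      using sub_le_iff[OF \<gamma>m] terminal_unique[OF T] b homD[OF t] by metis
    moreover have "\<exists>!h. h \<in> hom C Y (Dom C m) \<and> m \<cdot> h = u \<and> b \<cdot> h = v"
      if u: "u \<in> hom C Y X" and v: "v \<in> hom C Y T" and eq: "\<gamma> \<cdot> u = t \<cdot> v" for Y u v
    proof -
      have "sub_le C u m"
        using \<gamma>_iff[OF u] eq sub_le_comp_left[OF t v] by simp
      then obtain h where h: "h \<in> hom C Y (Dom C m)" "m \<cdot> h = u"
        using sub_le_iff[OF u] by auto
      moreover have "b \<cdot> h = v"
        using terminal_unique[OF T comp_hom[OF h(1) b] v] .
      ultimately show ?thesis
        using mono_cancel[OF is_subobjectD(2)[OF m(1)] m(2)] by blast
    qed
    ultimately show ?thesis
      using homD[OF \<gamma>] homD[OF t] m(2) b by (auto simp: is_pullback_def)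
  qed
  then have "is_pullback C \<alpha> t m b" "is_pullback C \<beta> t m b"
    using m_iff iff \<alpha> \<beta> by simp_all
  moreover have "\<exists>!\<chi>. \<chi> \<in> hom C X \<Omega> \<and> (\<exists>b. is_pullback C \<chi> t m b)"
    using cl is_subobjectD(2)[OF m(1)] homD[OF m(2)] unfolding is_subobject_classifier_def by blast
  ultimately show ?thesis
    using \<alpha> \<beta> by blast
qed

text \<open>The implication is the equalizer of the classifying arrows of \<open>\<Phi>\<close> and \<open>\<Phi> \<and> \<Psi>\<close>.\<close>

lemma representable_imp:
  assumes \<Phi>: "representable B \<Phi>" and \<Psi>: "representable B \<Psi>"
  shows "representable B (\<lambda>x. \<forall>Y. \<forall>y \<in> hom C Y (Dom C x). \<Phi> (x \<cdot> y) \<longrightarrow> \<Psi> (x \<cdot> y))"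
proof -
  obtain T \<Omega> t where cl: "is_subobject_classifier C T \<Omega> t"
    using classifier_exists by blast
  obtain \<chi> where \<chi>: "\<chi> \<in> hom C B \<Omega>"
      and \<chi>_iff: "\<And>X x. x \<in> hom C X B \<Longrightarrow> sub_le C (\<chi> \<cdot> x) t \<longleftrightarrow> \<Phi> x"
    using classify[OF cl \<Phi>] by blast
  obtain \<xi> where \<xi>: "\<xi> \<in> hom C B \<Omega>"
      and \<xi>_iff: "\<And>X x. x \<in> hom C X B \<Longrightarrow> sub_le C (\<xi> \<cdot> x) t \<longleftrightarrow> \<Phi> x \<and> \<Psi> x"
    using classify[OF cl representable_and[OF \<Phi> \<Psi>]] by blast
  show ?thesis
  proof (rule representable_cong[OF representable_eq[OF \<chi> \<xi>]])
    fix X x assume x: "x \<in> hom C X B"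
    have 1: "sub_le C (\<chi> \<cdot> x \<cdot> y) t \<longleftrightarrow> \<Phi> (x \<cdot> y)"
         "sub_le C (\<xi> \<cdot> x \<cdot> y) t \<longleftrightarrow> \<Phi> (x \<cdot> y) \<and> \<Psi> (x \<cdot> y)"
      if y: "y \<in> hom C Y X" for Y y
      using \<chi>_iff[OF comp_hom[OF y x]] \<xi>_iff[OF comp_hom[OF y x]]
        comp_assoc[OF y x \<chi>] comp_assoc[OF y x \<xi>] by auto
    show "\<chi> \<cdot> x = \<xi> \<cdot> x \<longleftrightarrow> (\<forall>Y. \<forall>y \<in> hom C Y (Dom C x). \<Phi> (x \<cdot> y) \<longrightarrow> \<Psi> (x \<cdot> y))"
      unfolding homD(2)[OF x]
    proof
      assume "\<chi> \<cdot> x = \<xi> \<cdot> x"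
      then show "\<forall>Y. \<forall>y \<in> hom C Y X. \<Phi> (x \<cdot> y) \<longrightarrow> \<Psi> (x \<cdot> y)"
        using 1 by metis
    next
      assume "\<forall>Y. \<forall>y \<in> hom C Y X. \<Phi> (x \<cdot> y) \<longrightarrow> \<Psi> (x \<cdot> y)"
      then show "\<chi> \<cdot> x = \<xi> \<cdot> x"
        using 1 by (intro classifier_ext[OF cl comp_hom[OF x \<chi>] comp_hom[OF x \<xi>]]) blast
    qed
  qed
qed

text \<open>\<open>mem e y\<close> is the membership relation of the power object \<open>E\<close> on generalized elements
  \<open>e : Z \<rightarrow> E\<close> and \<open>y : Z \<rightarrow> Y\<close>.\<close>

definition power_object :: "'o \<Rightarrow> 'o \<Rightarrow> ('a \<Rightarrow> 'a \<Rightarrow> bool) \<Rightarrow> bool" where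
  "power_object Y E mem \<longleftrightarrow>
     (\<forall>X. \<forall>e \<in> hom C X E. \<forall>e' \<in> hom C X E.
        (\<forall>Z. \<forall>z \<in> hom C Z X. \<forall>y \<in> hom C Z Y. mem (e \<cdot> z) y \<longleftrightarrow> mem (e' \<cdot> z) y) \<longrightarrow> e = e') \<and>
     (\<forall>B P p q \<Phi>. is_product C B Y P p q \<longrightarrow> representable P \<Phi> \<longrightarrow>
        (\<exists>e \<in> hom C B E. \<forall>Z. \<forall>w \<in> hom C Z P. mem (e \<cdot> (p \<cdot> w)) (q \<cdot> w) \<longleftrightarrow> \<Phi> w))"

lemma power_object_exists:
  assumes Y: "Y \<in> Obj C"
  obtains E mem where "power_object Y E mem"
proof -
  obtain T \<Omega> t where cl: "is_subobject_classifier C T \<Omega> t"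
    using classifier_exists by blast
  note t = classifierD(2)[OF cl]
  obtain E R r s ev where ex: "is_exponential C Y \<Omega> E R r s ev"
    using has_exponentials[OF Y classifierD(4)[OF cl]] by blast
  have R: "is_product C E Y R r s" and ev: "ev \<in> hom C R \<Omega>"
    using ex by (auto simp: is_exponential_def)
  have univ: "\<exists>!g. g \<in> hom C X E \<and>
      (\<exists>u \<in> hom C P R. r \<cdot> u = g \<cdot> p \<and> s \<cdot> u = q \<and> ev \<cdot> u = f)"
    if "is_product C X Y P p q" "f \<in> hom C P \<Omega>" for X P p q f
    using ex that unfolding is_exponential_def by blast
  note r = productD(1)[OF R] and s = productD(2)[OF R]
  \<comment> \<open>Membership says that evaluation is true at the pair \<open>w = (e, y)\<close> in
    the product of \<open>E\<close> and \<open>Y\<close>. The pair is unique by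
    \<open>product_ext\<close>, so the existential quantifier leaves no ambiguity.\<close>
  define mem where "mem e y \<longleftrightarrow>
    (\<exists>w \<in> hom C (Dom C e) R. r \<cdot> w = e \<and> s \<cdot> w = y \<and> sub_le C (ev \<cdot> w) t)" for e y
  have mem: "mem (r \<cdot> w) (s \<cdot> w) \<longleftrightarrow> sub_le C (ev \<cdot> w) t" if w: "w \<in> hom C Z R" for Z w
    using product_ext[OF R _ w] w homD(2)[OF comp_hom[OF w r]] unfolding mem_def by metis
  have mem_graph: "mem (g \<cdot> (p \<cdot> w)) (q \<cdot> w) \<longleftrightarrow> sub_le C (ev \<cdot> u \<cdot> w) t"
    if P: "is_product C X Y P p q" and g: "g \<in> hom C X E" and u: "u \<in> hom C P R"
      and eq: "r \<cdot> u = g \<cdot> p" "s \<cdot> u = q" and w: "w \<in> hom C Z P" for X P p q g u Z w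
  proof -
    have "g \<cdot> (p \<cdot> w) = r \<cdot> (u \<cdot> w)" "q \<cdot> w = s \<cdot> (u \<cdot> w)" "ev \<cdot> u \<cdot> w = ev \<cdot> (u \<cdot> w)"
      using comp_assoc[OF w productD(1)[OF P] g] comp_assoc[OF w u r] comp_assoc[OF w u s]
        comp_assoc[OF w u ev] eq by auto
    then show ?thesis
      using mem[OF comp_hom[OF w u]] by simp
  qed
  have "power_object Y E mem"
    unfolding power_object_def
  proof (intro conjI allI ballI impI)
    fix X e e' assume e: "e \<in> hom C X E" and e': "e' \<in> hom C X E"
      and iff: "\<forall>Z. \<forall>z \<in> hom C Z X. \<forall>y \<in> hom C Z Y. mem (e \<cdot> z) y \<longleftrightarrow> mem (e' \<cdot> z) y"
    obtain P p q where P: "is_product C X Y P p q"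
      using product_exists[OF homD(4)[OF e] Y] by blast
    note p = productD(1)[OF P] and q = productD(2)[OF P]
    obtain u where u: "u \<in> hom C P R" "r \<cdot> u = e \<cdot> p" "s \<cdot> u = q"
      using product_pair[OF R comp_hom[OF p e] q] by blast
    obtain u' where u': "u' \<in> hom C P R" "r \<cdot> u' = e' \<cdot> p" "s \<cdot> u' = q"
      using product_pair[OF R comp_hom[OF p e'] q] by blast
    have evu: "ev \<cdot> u \<in> hom C P \<Omega>" "ev \<cdot> u' \<in> hom C P \<Omega>"
      using comp_hom ev u u' by auto
    have "ev \<cdot> u = ev \<cdot> u'"
    proof (rule classifier_ext[OF cl evu])
      fix Z w assume w: "w \<in> hom C Z P"
      show "sub_le C (ev \<cdot> u \<cdot> w) t \<longleftrightarrow> sub_le C (ev \<cdot> u' \<cdot> w) t"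
        using mem_graph[OF P e u w] mem_graph[OF P e' u' w] iff comp_hom[OF w p] comp_hom[OF w q]
        by blast
    qed
    then show "e = e'"
      using univ[OF P evu(1)] e e' u u' by metis
  next
    fix B P p q \<Phi> assume P: "is_product C B Y P p q" and \<Phi>: "representable P \<Phi>"
    obtain \<chi> where \<chi>: "\<chi> \<in> hom C P \<Omega>"
      and \<chi>_iff: "\<And>X x. x \<in> hom C X P \<Longrightarrow> sub_le C (\<chi> \<cdot> x) t \<longleftrightarrow> \<Phi> x"
      using classify[OF cl \<Phi>] by blast
    obtain g u where g: "g \<in> hom C B E" and u: "u \<in> hom C P R" "r \<cdot> u = g \<cdot> p" "s \<cdot> u = q"
        and "ev \<cdot> u = \<chi>"
      using univ[OF P \<chi>] by blast
    then show "\<exists>e \<in> hom C B E. \<forall>Z. \<forall>w \<in> hom C Z P. mem (e \<cdot> (p \<cdot> w)) (q \<cdot> w) \<longleftrightarrow> \<Phi> w"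
      using mem_graph[OF P g u] \<chi>_iff by blast
  qed
  then show ?thesis
    using that by blast
qed

lemma power_object_ext:
  assumes "power_object Y E mem" "e \<in> hom C X E" "e' \<in> hom C X E"
    and "\<And>Z z y. z \<in> hom C Z X \<Longrightarrow> y \<in> hom C Z Y \<Longrightarrow> mem (e \<cdot> z) y \<longleftrightarrow> mem (e' \<cdot> z) y"
  shows "e = e'"
proof -
  have "(\<forall>Z. \<forall>z \<in> hom C Z X. \<forall>y \<in> hom C Z Y. mem (e \<cdot> z) y \<longleftrightarrow> mem (e' \<cdot> z) y) \<longrightarrow> e = e'"
    using assms(1-3) unfolding power_object_def by simp
  then show ?thesis
    using assms(4) by simp
qed

lemma power_object_comprehension:
  assumes "power_object Y E mem" "is_product C B Y P p q" "representable P \<Phi>"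
  obtains e where "e \<in> hom C B E"
    "\<And>Z w. w \<in> hom C Z P \<Longrightarrow> mem (e \<cdot> (p \<cdot> w)) (q \<cdot> w) \<longleftrightarrow> \<Phi> w"
proof -
  have "\<exists>e \<in> hom C B E. \<forall>Z. \<forall>w \<in> hom C Z P. mem (e \<cdot> (p \<cdot> w)) (q \<cdot> w) \<longleftrightarrow> \<Phi> w"
    using assms unfolding power_object_def by blast
  then show ?thesis
    using that by blast
qed

text \<open>The map from \<open>y\<close> to the set \<open>{y}\<close>, which is the transpose of
  equality. It is monic because \<open>b\<close> lies in its own singleton. An arrow into
  \<open>E\<close> whose values are singletons factors through \<open>s\<close>, which is the
  principle of unique choice.\<close>

lemma singleton:
  assumes E: "power_object Y E mem" and Y: "Y \<in> Obj C"
  obtains s where "s \<in> hom C Y E" "is_subobject C E s"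
    "\<And>Z a b. a \<in> hom C Z Y \<Longrightarrow> b \<in> hom C Z Y \<Longrightarrow> mem (s \<cdot> a) b \<longleftrightarrow> a = b"
proof -
  obtain P p q where P: "is_product C Y Y P p q"
    using product_exists[OF Y Y] by blast
  obtain s where s: "s \<in> hom C Y E"
      and s_iff: "\<And>Z w. w \<in> hom C Z P \<Longrightarrow> mem (s \<cdot> (p \<cdot> w)) (q \<cdot> w) \<longleftrightarrow> p \<cdot> w = q \<cdot> w"
    using power_object_comprehension[OF E P representable_eq[OF productD(1,2)[OF P]]] by blast
  have mem: "mem (s \<cdot> a) b \<longleftrightarrow> a = b" if "a \<in> hom C Z Y" "b \<in> hom C Z Y" for Z a b
    using product_pair[OF P that] s_iff by metis
  have "is_subobject C E s"
    using mem by (intro is_subobjectI[OF s]) metis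
  then show ?thesis
    using that s mem by blast
qed

text \<open>Universal quantification over \<open>Y\<close>: the set of \<open>y\<close> with
  \<open>\<Phi> (x, y)\<close> is all of \<open>Y\<close>, so the extension is the equalizer of the
  transposes of \<open>\<Phi>\<close> and of truth. The arrows \<open>w\<close> over
  \<open>x \<cdot> z\<close> are the pairs of \<open>x\<close>, at a later stage, with an arbitrary
  element of \<open>Y\<close>.\<close>

lemma representable_all:
  assumes P: "is_product C B Y P p q" and \<Phi>: "representable P \<Phi>"
  shows "representable B
    (\<lambda>x. \<forall>Z. \<forall>w \<in> hom C Z P. (\<exists>z \<in> hom C Z (Dom C x). p \<cdot> w = x \<cdot> z) \<longrightarrow> \<Phi> w)"
proof -
  note B = productD(3)[OF P] and Y = productD(4)[OF P] and p = productD(1)[OF P]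
    and q = productD(2)[OF P]
  obtain E mem where E: "power_object Y E mem"
    using power_object_exists[OF Y] by blast
  obtain e where e: "e \<in> hom C B E"
      and e_iff: "\<And>Z w. w \<in> hom C Z P \<Longrightarrow> mem (e \<cdot> (p \<cdot> w)) (q \<cdot> w) \<longleftrightarrow> \<Phi> w"
    using power_object_comprehension[OF E P \<Phi>] by blast
  obtain a where a: "a \<in> hom C B E"
      and a_iff: "\<And>Z w. w \<in> hom C Z P \<Longrightarrow> mem (a \<cdot> (p \<cdot> w)) (q \<cdot> w) \<longleftrightarrow> True"
    using power_object_comprehension[OF E P representable_True[OF productD(5)[OF P]]] by blast
  show ?thesis
  proof (rule representable_cong[OF representable_eq[OF e a]])
    fix X x assume x: "x \<in> hom C X B"
    show "e \<cdot> x = a \<cdot> x \<longleftrightarrow>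
      (\<forall>Z. \<forall>w \<in> hom C Z P. (\<exists>z \<in> hom C Z (Dom C x). p \<cdot> w = x \<cdot> z) \<longrightarrow> \<Phi> w)"
      unfolding homD(2)[OF x]
    proof (intro iffI allI ballI impI)
      fix Z w assume eq: "e \<cdot> x = a \<cdot> x" and w: "w \<in> hom C Z P"
        and "\<exists>z \<in> hom C Z X. p \<cdot> w = x \<cdot> z"
      then obtain z where z: "z \<in> hom C Z X" "p \<cdot> w = x \<cdot> z"
        by blast
      have "e \<cdot> (p \<cdot> w) = a \<cdot> (p \<cdot> w)"
        using comp_assoc[OF z(1) x e] comp_assoc[OF z(1) x a] eq z(2) by simp
      then show "\<Phi> w"
        using e_iff[OF w] a_iff[OF w] by simp
    next
      assume all: "\<forall>Z. \<forall>w \<in> hom C Z P. (\<exists>z \<in> hom C Z X. p \<cdot> w = x \<cdot> z) \<longrightarrow> \<Phi> w"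
      show "e \<cdot> x = a \<cdot> x"
      proof (rule power_object_ext[OF E comp_hom[OF x e] comp_hom[OF x a]])
        fix Z z y assume z: "z \<in> hom C Z X" and y: "y \<in> hom C Z Y"
        obtain w where w: "w \<in> hom C Z P" "p \<cdot> w = x \<cdot> z" "q \<cdot> w = y"
          using product_pair[OF P comp_hom[OF z x] y] by blast
        then show "mem (e \<cdot> x \<cdot> z) y \<longleftrightarrow> mem (a \<cdot> x \<cdot> z) y"
          using comp_assoc[OF z x e] comp_assoc[OF z x a] e_iff[OF w(1)] a_iff[OF w(1)] all z
          by auto
      qed
    qed
  qed
qed

section \<open>The strict initial object\<close>

text \<open>Logically, \<open>Z\<close> is an inconsistent stage: every representable predicate
  holds there. This characterizes initial objects by a condition on subobjects alone, which the
  subobject order of \<open>is_complement\<close> can deliver.\<close>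

definition subobjects_trivial :: "'o \<Rightarrow> bool" where
  "subobjects_trivial Z \<longleftrightarrow> Z \<in> Obj C \<and> (\<forall>m. is_subobject C Z m \<longrightarrow> sub_le C (Id C Z) m)"

lemma subobjects_trivial_representable:
  assumes "subobjects_trivial Z" "representable Z \<Phi>"
  shows "\<Phi> (Id C Z)"
  using assms id_hom[of Z] unfolding subobjects_trivial_def representable_def by metis

lemma subobjects_trivial_arrows_eq:
  assumes Z: "subobjects_trivial Z" and f: "f \<in> hom C Z Y" and g: "g \<in> hom C Z Y"
  shows "f = g"
  using subobjects_trivial_representable[OF Z representable_eq[OF f g]]
    id_right[OF f] id_right[OF g] by simp

text \<open>A subobject of \<open>X\<close> gives an arrow \<open>Z \<rightarrow> P X\<close>, and there is only one such arrow.\<close>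

lemma subobjects_trivial_strict:
  assumes Z: "subobjects_trivial Z" and x: "x \<in> hom C X Z"
  shows "subobjects_trivial X"
  unfolding subobjects_trivial_def
proof (intro conjI allI impI)
  show X: "X \<in> Obj C"
    using homD[OF x] by simp
  fix m assume m: "is_subobject C X m"
  obtain E mem where E: "power_object X E mem"
    using power_object_exists[OF X] by blast
  obtain P p q where P: "is_product C Z X P p q"
    using product_exists[OF homD(5)[OF x] X] by blast
  obtain e where e: "e \<in> hom C Z E"
      and e_iff: "\<And>Z w. w \<in> hom C Z P \<Longrightarrow> mem (e \<cdot> (p \<cdot> w)) (q \<cdot> w) \<longleftrightarrow> sub_le C (q \<cdot> w) m"
    using power_object_comprehension[OF E P
        representable_pullback[OF productD(2)[OF P] representable_subobject[OF m]]] by blast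
  obtain a where a: "a \<in> hom C Z E"
      and a_iff: "\<And>Z w. w \<in> hom C Z P \<Longrightarrow> mem (a \<cdot> (p \<cdot> w)) (q \<cdot> w) \<longleftrightarrow> True"
    using power_object_comprehension[OF E P representable_True[OF productD(5)[OF P]]] by blast
  obtain w where w: "w \<in> hom C X P" "q \<cdot> w = Id C X"
    using product_pair[OF P x id_hom[OF X]] by blast
  show "sub_le C (Id C X) m"
    using e_iff[OF w(1)] a_iff[OF w(1)] w(2) subobjects_trivial_arrows_eq[OF Z e a] by simp
qed

text \<open>Unique choice at an inconsistent stage: any arrow from \<open>Z\<close> to the power
  object, here the one naming all of \<open>Y\<close>, has singleton values, because everything
  holds at \<open>Z\<close>.\<close>

lemma subobjects_trivial_arrow_exists:
  assumes Z: "subobjects_trivial Z" and Y: "Y \<in> Obj C"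
  shows "\<exists>f. f \<in> hom C Z Y"
proof -
  have ZO: "Z \<in> Obj C"
    using Z by (simp add: subobjects_trivial_def)
  obtain E mem where E: "power_object Y E mem"
    using power_object_exists[OF Y] by blast
  obtain s where s: "s \<in> hom C Y E" "is_subobject C E s"
    using singleton[OF E Y] by metis
  obtain P p q where P: "is_product C Z Y P p q"
    using product_exists[OF ZO Y] by blast
  obtain e where e: "e \<in> hom C Z E"
    using power_object_comprehension[OF E P representable_True[OF productD(5)[OF P]]] by metis
  have "sub_le C (e \<cdot> Id C Z) s"
    using subobjects_trivial_representable[OF Z
        representable_pullback[OF e representable_subobject[OF s(2)]]] .
  then show ?thesis
    using sub_le_iff[OF e] id_right[OF e] homD[OF s(1)] by auto
qed

lemma is_initial_iff: "is_initial C Z \<longleftrightarrow> subobjects_trivial Z"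
proof
  assume Z: "is_initial C Z"
  then have ZO: "Z \<in> Obj C"
    by (simp add: is_initial_def)
  have "sub_le C (Id C Z) m" if m: "is_subobject C Z m" for m
  proof -
    note mh = is_subobjectD(1)[OF m]
    obtain k where k: "k \<in> hom C Z (Dom C m)"
      using Z homD[OF mh] unfolding is_initial_def by blast
    have "m \<cdot> k = Id C Z"
      using Z ZO comp_hom[OF k mh] id_hom[OF ZO] unfolding is_initial_def by blast
    then show ?thesis
      using sub_le_comp_left[OF mh k] by simp
  qed
  then show "subobjects_trivial Z"
    using ZO by (simp add: subobjects_trivial_def)
next
  assume Z: "subobjects_trivial Z"
  then show "is_initial C Z"
    using subobjects_trivial_arrow_exists[OF Z] subobjects_trivial_arrows_eq[OF Z]
    unfolding is_initial_def subobjects_trivial_def by blast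
qed

lemma initial_strict:
  assumes "is_initial C Z" "x \<in> hom C X Z"
  shows "is_initial C X"
  using assms subobjects_trivial_strict is_initial_iff by blast

lemma initial_arrows_eq:
  assumes "is_initial C Z" "f \<in> hom C Z Y" "g \<in> hom C Z Y"
  shows "f = g"
  using assms homD(5)[OF assms(2)] unfolding is_initial_def by blast

lemma initial_sub_le:
  assumes Z: "is_initial C Z" and x: "x \<in> hom C Z B" and m: "m \<in> hom C M B"
  shows "sub_le C x m"
proof -
  obtain k where k: "k \<in> hom C Z M"
    using Z homD[OF m] unfolding is_initial_def by blast
  have "m \<cdot> k = x"
    using initial_arrows_eq[OF Z comp_hom[OF k m] x] .
  then show ?thesis
    using sub_le_comp_left[OF m k] by simp
qed

text \<open>The initial object is the subobject \<open>\<forall>\<omega>. \<omega>\<close> of \<open>1\<close>.\<close>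

lemma initial_exists:
  assumes T: "is_terminal C T"
  obtains m where "is_subobject C T m" "is_initial C (Dom C m)"
proof -
  obtain U \<Omega> t where cl: "is_subobject_classifier C U \<Omega> t"
    using classifier_exists by blast
  have TO: "T \<in> Obj C"
    using T by (simp add: is_terminal_def)
  obtain P p q where P: "is_product C T \<Omega> P p q"
    using product_exists[OF TO classifierD(4)[OF cl]] by blast
  obtain m where m: "is_subobject C T m" "m \<in> hom C (Dom C m) T"
      and m_iff: "\<And>X x. x \<in> hom C X T \<Longrightarrow> sub_le C x m \<longleftrightarrow>
        (\<forall>Z. \<forall>w \<in> hom C Z P. (\<exists>z \<in> hom C Z (Dom C x). p \<cdot> w = x \<cdot> z) \<longrightarrow> sub_le C (q \<cdot> w) t)"
    using representableE[OF representable_all[OF P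
      representable_pullback[OF productD(2)[OF P] representable_subobject[OF classifierD(3)[OF cl]]]]]
    by blast
  let ?Z = "Dom C m"
  have Z: "?Z \<in> Obj C"
    using homD[OF m(2)] by simp
  have "sub_le C (Id C ?Z) n" if n: "is_subobject C ?Z n" for n
  proof -
    \<comment> \<open>At the stage \<open>m\<close> every truth value is true. Instantiating with
      the characteristic arrow of \<open>n\<close> makes \<open>n\<close> the whole object.\<close>
    obtain \<chi> where \<chi>: "\<chi> \<in> hom C ?Z \<Omega>"
      and \<chi>_iff: "\<And>X x. x \<in> hom C X ?Z \<Longrightarrow> sub_le C (\<chi> \<cdot> x) t \<longleftrightarrow> sub_le C x n"
      using classify[OF cl representable_subobject[OF n]] by blast
    obtain w where w: "w \<in> hom C ?Z P" "p \<cdot> w = m" "q \<cdot> w = \<chi>"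
      using product_pair[OF P m(2) \<chi>] by blast
    have "sub_le C (q \<cdot> w) t"
      using m_iff[OF m(2)] sub_le_refl[OF m(2)] w id_right[OF m(2)] id_hom[OF Z] by metis
    then show ?thesis
      using \<chi>_iff[OF id_hom[OF Z]] w(3) id_right[OF \<chi>] by simp
  qed
  then have "is_initial C ?Z"
    using Z by (simp add: is_initial_iff subobjects_trivial_def)
  then show ?thesis
    using that m by blast
qed

text \<open>The formula false: in Kripke-Joyal semantics it holds at initial stages only. Strictness
  makes the arrow from the initial object to \<open>B\<close> monic and makes everything that
  factors through it have an initial domain.\<close>

lemma representable_initial:
  assumes B: "B \<in> Obj C"
  shows "representable B (\<lambda>x. is_initial C (Dom C x))"
proof -
  obtain T where "is_terminal C T"
    using has_terminal by blast
  then obtain Z where Z: "is_initial C Z"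
    using initial_exists by metis
  then obtain m where m: "m \<in> hom C Z B"
    using B unfolding is_initial_def by blast
  have "is_subobject C B m"
    using initial_strict[OF Z] initial_arrows_eq by (intro is_subobjectI[OF m]) blast
  moreover have "sub_le C x m \<longleftrightarrow> is_initial C (Dom C x)" if x: "x \<in> hom C X B" for X x
    using sub_le_iff[OF x] initial_strict[OF Z] initial_sub_le[OF _ x m] homD(2)[OF m] homD(2)[OF x]
    by auto
  ultimately show ?thesis
    unfolding representable_def by blast
qed

lemma representable_not:
  assumes \<Phi>: "representable B \<Phi>" and B: "B \<in> Obj C"
  shows "representable B (\<lambda>x. \<forall>Y. \<forall>y \<in> hom C Y (Dom C x). \<Phi> (x \<cdot> y) \<longrightarrow> is_initial C Y)"
proof (rule representable_cong[OF representable_imp[OF \<Phi> representable_initial[OF B]]])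
  fix X x assume x: "x \<in> hom C X B"
  have "Dom C (x \<cdot> y) = Y" if "y \<in> hom C Y X" for Y y
    using homD(2)[OF comp_hom[OF that x]] .
  then show "(\<forall>Y. \<forall>y \<in> hom C Y (Dom C x). \<Phi> (x \<cdot> y) \<longrightarrow> is_initial C (Dom C (x \<cdot> y)))
      \<longleftrightarrow> (\<forall>Y. \<forall>y \<in> hom C Y (Dom C x). \<Phi> (x \<cdot> y) \<longrightarrow> is_initial C Y)"
    unfolding homD(2)[OF x] by auto
qed

section \<open>Complements\<close>

lemma complementD:
  assumes "is_complement C B m n"
  shows "is_subobject C B m" "is_subobject C B n" "m \<in> hom C (Dom C m) B" "n \<in> hom C (Dom C n) B"
  using assms is_subobjectD unfolding is_complement_def by auto

text \<open>The definition only says that the meet \<open>u\<close> is least among the subobjects of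
  \<open>B\<close>. A subobject of \<open>Dom C u\<close> becomes one of \<open>B\<close> by
  composing with \<open>u\<close>, so it must be everything; hence \<open>Dom C u\<close> is
  initial, and strictness passes this on to \<open>X\<close>.\<close>

lemma complement_meet:
  assumes mn: "is_complement C B m n"
    and x: "x \<in> hom C X B" "sub_le C x m" "sub_le C x n"
  shows "is_initial C X"
proof -
  obtain u where u: "is_subobject C B u" "u \<in> hom C (Dom C u) B"
      and u_iff: "\<And>X x. x \<in> hom C X B \<Longrightarrow> sub_le C x u \<longleftrightarrow> sub_le C x m \<and> sub_le C x n"
    using representableE[OF representable_and[OF
        representable_subobject[OF complementD(1)[OF mn]]
        representable_subobject[OF complementD(2)[OF mn]]]] by blast
  let ?U = "Dom C u"
  have U: "?U \<in> Obj C"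
    using homD[OF u(2)] by simp
  have least: "sub_le C u v" if "is_subobject C B v" for v
    using mn u(1) that u_iff[OF u(2)] sub_le_refl[OF u(2)] unfolding is_complement_def by blast
  have "sub_le C (Id C ?U) v" if v: "is_subobject C ?U v" for v
  proof -
    note vh = is_subobjectD(1)[OF v]
    obtain k where k: "k \<in> hom C ?U (Dom C v)" "u \<cdot> v \<cdot> k = u"
      using least[OF subobject_comp[OF u(1) v]] sub_le_iff[OF u(2)] homD(2)[OF comp_hom[OF vh u(2)]]
      by auto
    have "u \<cdot> (v \<cdot> k) = u \<cdot> Id C ?U"
      using comp_assoc[OF k(1) vh u(2)] k(2) id_right[OF u(2)] by simp
    then have "v \<cdot> k = Id C ?U"
      using mono_cancel[OF is_subobjectD(2)[OF u(1)] u(2) comp_hom[OF k(1) vh] id_hom[OF U]] by simp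
    then show ?thesis
      using sub_le_comp_left[OF vh k(1)] by simp
  qed
  then have "is_initial C ?U"
    using U by (simp add: is_initial_iff subobjects_trivial_def)
  then show ?thesis
    using u_iff[OF x(1)] x sub_le_iff[OF x(1)] initial_strict by blast
qed

lemma complement_join:
  assumes mn: "is_complement C B m n" and u: "is_subobject C B u" "sub_le C m u" "sub_le C n u"
  shows "sub_le C (Id C B) u"
proof -
  have B: "B \<in> Obj C"
    using homD(5)[OF complementD(3)[OF mn]] .
  have "is_subobject C B (Id C B)"
    using id_left by (intro is_subobjectI[OF id_hom[OF B]]) metis
  then show ?thesis
    using mn u unfolding is_complement_def by blast
qed

text \<open>Pullback along \<open>x\<close> preserves joins because it has a right adjoint on subobjects,
  \<open>\<forall>\<^sub>x u = {b. \<forall>a. b = x a \<longrightarrow> a \<in> u}\<close>.\<close>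

lemma complement_cover_subobject:
  assumes mn: "is_complement C B m n" and x: "x \<in> hom C X B" and u: "is_subobject C X u"
    and um: "\<And>Y y. y \<in> hom C Y X \<Longrightarrow> sub_le C (x \<cdot> y) m \<Longrightarrow> sub_le C y u"
    and un: "\<And>Y y. y \<in> hom C Y X \<Longrightarrow> sub_le C (x \<cdot> y) n \<Longrightarrow> sub_le C y u"
  shows "sub_le C (Id C X) u"
proof -
  have B: "B \<in> Obj C" and X: "X \<in> Obj C"
    using homD[OF x] by auto
  obtain P p q where P: "is_product C B X P p q"
    using product_exists[OF B X] by blast
  note p = productD(1)[OF P] and q = productD(2)[OF P]
  let ?\<Phi> = "\<lambda>w. \<forall>Y. \<forall>y \<in> hom C Y (Dom C w). p \<cdot> (w \<cdot> y) = x \<cdot> q \<cdot> (w \<cdot> y) \<longrightarrow> sub_le C (q \<cdot> (w \<cdot> y)) u"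
  have \<Phi>: "representable P ?\<Phi>"
    using representable_imp[OF representable_eq[OF p comp_hom[OF q x]]
        representable_pullback[OF q representable_subobject[OF u]]] .
  obtain r where r: "is_subobject C B r" "r \<in> hom C (Dom C r) B"
      and r_iff: "\<And>X x. x \<in> hom C X B \<Longrightarrow> sub_le C x r \<longleftrightarrow>
        (\<forall>Z. \<forall>w \<in> hom C Z P. (\<exists>z \<in> hom C Z (Dom C x). p \<cdot> w = x \<cdot> z) \<longrightarrow> ?\<Phi> w)"
    using representableE[OF representable_all[OF P \<Phi>]] by blast
  \<comment> \<open>One half of the adjunction: if the preimage of \<open>k\<close> under
    \<open>x\<close> lies in \<open>u\<close>, then \<open>k\<close> lies in \<open>r\<close>. It is
    applied to \<open>m\<close> and to \<open>n\<close>.\<close>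
  have le: "sub_le C k r"
    if k: "k \<in> hom C K B" and uk: "\<And>Y y. y \<in> hom C Y X \<Longrightarrow> sub_le C (x \<cdot> y) k \<Longrightarrow> sub_le C y u"
    for k K
    unfolding r_iff[OF k] homD(2)[OF k]
  proof (intro allI ballI impI)
    fix Z w Y y assume w: "w \<in> hom C Z P" and "\<exists>z \<in> hom C Z K. p \<cdot> w = k \<cdot> z"
      and "y \<in> hom C Y (Dom C w)" and eq: "p \<cdot> (w \<cdot> y) = x \<cdot> q \<cdot> (w \<cdot> y)"
    then obtain z where z: "z \<in> hom C Z K" "p \<cdot> w = k \<cdot> z" and y: "y \<in> hom C Y Z"
      using homD(2)[OF w] by auto
    have "x \<cdot> (q \<cdot> (w \<cdot> y)) = k \<cdot> (z \<cdot> y)"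
      using comp_assoc[OF comp_hom[OF y w] q x] comp_assoc[OF y w p] comp_assoc[OF y z(1) k] z(2) eq
      by simp
    then show "sub_le C (q \<cdot> (w \<cdot> y)) u"
      using uk[OF comp_hom[OF comp_hom[OF y w] q]] sub_le_comp_left[OF k comp_hom[OF y z(1)]] by simp
  qed
  have "sub_le C (Id C B) r"
    using complement_join[OF mn r(1)] le[OF complementD(3)[OF mn]] le[OF complementD(4)[OF mn]] um un
    by blast
  then have "sub_le C x r"
    using sub_le_if_id[OF r(2) _ x] by simp
  \<comment> \<open>The other half: the formula for \<open>r\<close> is instantiated with
    \<open>b\<close> equal to \<open>x\<close> and \<open>a\<close> equal to the identity, the
    generic element of \<open>X\<close>.\<close>
  moreover obtain w where w: "w \<in> hom C X P" "p \<cdot> w = x" "q \<cdot> w = Id C X"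
    using product_pair[OF P x id_hom[OF X]] by blast
  moreover have "x \<cdot> Id C X = x" "w \<cdot> Id C X = w" "x \<cdot> q \<cdot> w = x"
    using id_right[OF x] id_right[OF w(1)] comp_assoc[OF w(1) q x] w(3) by auto
  ultimately show ?thesis
    using id_hom[OF X] homD(2)[OF x] homD(2)[OF w(1)] unfolding r_iff[OF x] by metis
qed

text \<open>Proof by cases in the internal language. The element \<open>x\<close> lies in
  \<open>m\<close> or in \<open>n\<close> only after passing to parts of \<open>X\<close>;
  representability of \<open>\<Phi>\<close> lets the conclusion descend from those parts to
  \<open>X\<close>.\<close>

lemma complement_cover:
  assumes mn: "is_complement C B m n" and x: "x \<in> hom C X B"
    and \<Phi>: "representable A \<Phi>" and a: "a \<in> hom C X A"
    and "\<And>Y y. y \<in> hom C Y X \<Longrightarrow> sub_le C (x \<cdot> y) m \<Longrightarrow> \<Phi> (a \<cdot> y)"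
    and "\<And>Y y. y \<in> hom C Y X \<Longrightarrow> sub_le C (x \<cdot> y) n \<Longrightarrow> \<Phi> (a \<cdot> y)"
  shows "\<Phi> a"
proof -
  obtain u where u: "is_subobject C X u" "u \<in> hom C (Dom C u) X"
      and u_iff: "\<And>Y y. y \<in> hom C Y X \<Longrightarrow> sub_le C y u \<longleftrightarrow> \<Phi> (a \<cdot> y)"
    using representableE[OF representable_pullback[OF a \<Phi>]] by blast
  have "sub_le C (Id C X) u"
    by (rule complement_cover_subobject[OF mn x u(1)]) (simp_all add: assms(5,6) u_iff)
  then show ?thesis
    using u_iff[OF id_hom[OF homD(4)[OF x]]] id_right[OF a] by simp
qed

lemma is_complementI:
  assumes m: "is_subobject C B m" and n: "is_subobject C B n"
    and meet: "\<And>X x. x \<in> hom C X B \<Longrightarrow> sub_le C x m \<Longrightarrow> sub_le C x n \<Longrightarrow> is_initial C X"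
    and join: "\<And>u. is_subobject C B u \<Longrightarrow> sub_le C m u \<Longrightarrow> sub_le C n u \<Longrightarrow> sub_le C (Id C B) u"
  shows "is_complement C B m n"
  unfolding is_complement_def
proof (intro conjI allI impI m n)
  fix u v assume "is_subobject C B u \<and> sub_le C u m \<and> sub_le C u n" and v: "is_subobject C B v"
  then show "sub_le C u v"
    using initial_sub_le[OF meet] is_subobjectD(1)[of B] by metis
next
  fix u v assume "is_subobject C B u \<and> sub_le C m u \<and> sub_le C n u" and v: "is_subobject C B v"
  then show "sub_le C v u"
    using sub_le_if_id join is_subobjectD(1) by metis
qed

text \<open>Used for preimages of a complemented diagonal: the diagonal of a subobject, and the
  locus where an element equals a fixed point.\<close>

lemma complement_pullback:
  assumes mn: "is_complement C B m n" and x: "x \<in> hom C X B"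
    and m': "is_subobject C X m'" and n': "is_subobject C X n'"
    and m'_iff: "\<And>Y y. y \<in> hom C Y X \<Longrightarrow> sub_le C y m' \<longleftrightarrow> sub_le C (x \<cdot> y) m"
    and n'_iff: "\<And>Y y. y \<in> hom C Y X \<Longrightarrow> sub_le C y n' \<longleftrightarrow> sub_le C (x \<cdot> y) n"
  shows "is_complement C X m' n'"
proof (rule is_complementI[OF m' n'])
  fix Y y assume y: "y \<in> hom C Y X" "sub_le C y m'" "sub_le C y n'"
  then show "is_initial C Y"
    using complement_meet[OF mn comp_hom[OF y(1) x]] m'_iff n'_iff by blast
next
  fix u assume u: "is_subobject C X u" "sub_le C m' u" "sub_le C n' u"
  show "sub_le C (Id C X) u"
  proof (rule complement_cover_subobject[OF mn x u(1)])
    fix Y y assume y: "y \<in> hom C Y X" "sub_le C (x \<cdot> y) m"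
    then show "sub_le C y u"
      using sub_le_trans[OF y(1) is_subobjectD(1)[OF m'] is_subobjectD(1)[OF u(1)]] m'_iff u(2) by blast
  next
    fix Y y assume y: "y \<in> hom C Y X" "sub_le C (x \<cdot> y) n"
    then show "sub_le C y u"
      using sub_le_trans[OF y(1) is_subobjectD(1)[OF n'] is_subobjectD(1)[OF u(1)]] n'_iff u(3) by blast
  qed
qed

text \<open>Over \<open>m\<close> the implication forces a related pair onto the graph
  \<open>d\<close> of \<open>f\<close>, while \<open>\<Psi>\<close> holds on that graph anyway, so
  the fibre of the relation is the singleton of \<open>f\<close>. Keeping \<open>\<Psi>\<close>
  abstract lets both halves of the gluing relation play the first role.\<close>

lemma singleton_of_graph:
  assumes E: "power_object Y E mem" and P: "is_product C B Y P p q"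
    and e: "e \<in> hom C B E"
    and e_iff: "\<And>Z w. w \<in> hom C Z P \<Longrightarrow> mem (e \<cdot> (p \<cdot> w)) (q \<cdot> w) \<longleftrightarrow>
       (\<forall>Y. \<forall>y \<in> hom C Y (Dom C w). sub_le C (p \<cdot> (w \<cdot> y)) m \<longrightarrow> sub_le C (w \<cdot> y) d) \<and> \<Psi> w"
    and s: "s \<in> hom C Y E"
    and s_iff: "\<And>Z a b. a \<in> hom C Z Y \<Longrightarrow> b \<in> hom C Z Y \<Longrightarrow> mem (s \<cdot> a) b \<longleftrightarrow> a = b"
    and m: "is_subobject C B m" and d: "d \<in> hom C (Dom C m) P" "p \<cdot> d = m" "q \<cdot> d = f"
    and \<Psi>: "\<And>Z z. z \<in> hom C Z (Dom C m) \<Longrightarrow> \<Psi> (d \<cdot> z)"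
  shows "e \<cdot> m = s \<cdot> f"
proof -
  note p = productD(1)[OF P] and q = productD(2)[OF P] and mh = is_subobjectD(1)[OF m]
  have f: "f \<in> hom C (Dom C m) Y"
    using d comp_hom[OF d(1) q] by simp
  show ?thesis
  proof (rule power_object_ext[OF E comp_hom[OF mh e] comp_hom[OF f s]])
    fix Z z y assume z: "z \<in> hom C Z (Dom C m)" and y: "y \<in> hom C Z Y"
    have pd: "p \<cdot> (d \<cdot> k) = m \<cdot> k" "q \<cdot> (d \<cdot> k) = f \<cdot> k" if "k \<in> hom C K (Dom C m)" for K k
      using comp_assoc[OF that d(1) p] comp_assoc[OF that d(1) q] d by auto
    have fz: "f \<cdot> z \<in> hom C Z Y" and mz: "m \<cdot> z \<in> hom C Z B" and dz: "d \<cdot> z \<in> hom C Z P"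
      using comp_hom z f mh d by auto
    obtain w where w: "w \<in> hom C Z P" "p \<cdot> w = m \<cdot> z" "q \<cdot> w = y"
      using product_pair[OF P mz y] by blast
    have "mem (e \<cdot> m \<cdot> z) y \<longleftrightarrow> mem (e \<cdot> (p \<cdot> w)) (q \<cdot> w)"
      using comp_assoc[OF z mh e] w by simp
    also have "\<dots> \<longleftrightarrow> f \<cdot> z = y"
    proof
      assume "mem (e \<cdot> (p \<cdot> w)) (q \<cdot> w)"
      then have "sub_le C (p \<cdot> (w \<cdot> Id C Z)) m \<longrightarrow> sub_le C (w \<cdot> Id C Z) d"
        using e_iff[OF w(1)] id_hom[OF homD(4)[OF z]] homD(2)[OF w(1)] by simp
      then have "sub_le C w d"
        using id_right[OF w(1)] w(2) sub_le_comp_left[OF mh z] by simp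
      then obtain k where k: "k \<in> hom C Z (Dom C m)" "d \<cdot> k = w"
        using sub_le_iff[OF w(1)] homD(2)[OF d(1)] by auto
      then have "k = z"
        using pd[OF k(1)] w(2) mono_cancel[OF is_subobjectD(2)[OF m] mh k(1) z] by simp
      then show "f \<cdot> z = y"
        using pd[OF k(1)] k w by simp
    next
      assume "f \<cdot> z = y"
      then have wd: "w = d \<cdot> z"
        using product_ext[OF P w(1) dz] pd[OF z] w by simp
      have "sub_le C (w \<cdot> y) d" if y: "y \<in> hom C X Z" for X y
        using wd comp_assoc[OF y z d(1)] sub_le_comp_left[OF d(1) comp_hom[OF y z]] by simp
      then show "mem (e \<cdot> (p \<cdot> w)) (q \<cdot> w)"
        using e_iff[OF w(1)] \<Psi>[OF z] wd homD(2)[OF w(1)] by simp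
    qed
    also have "\<dots> \<longleftrightarrow> mem (s \<cdot> f \<cdot> z) y"
      using s_iff[OF fz y] comp_assoc[OF z f s] by simp
    finally show "mem (e \<cdot> m \<cdot> z) y \<longleftrightarrow> mem (s \<cdot> f \<cdot> z) y" .
  qed
qed

text \<open>The glued arrow is obtained by unique choice from the relation
  \<open>(b \<in> m \<longrightarrow> (b, y) \<in> graph f) \<and> (b \<in> n \<longrightarrow> (b, y) \<in> graph g)\<close>.\<close>

lemma complement_glue:
  assumes mn: "is_complement C B m n" and f: "f \<in> hom C (Dom C m) Y" and g: "g \<in> hom C (Dom C n) Y"
  obtains h where "h \<in> hom C B Y" "h \<cdot> m = f" "h \<cdot> n = g"
proof -
  note ms = complementD(1)[OF mn] and ns = complementD(2)[OF mn]
    and m = complementD(3)[OF mn] and n = complementD(4)[OF mn]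
  have B: "B \<in> Obj C" and Y: "Y \<in> Obj C"
    using homD[OF m] homD[OF f] by auto
  obtain P p q where P: "is_product C B Y P p q"
    using product_exists[OF B Y] by blast
  note p = productD(1)[OF P] and q = productD(2)[OF P]
  obtain E mem where E: "power_object Y E mem"
    using power_object_exists[OF Y] by blast
  obtain s where s: "s \<in> hom C Y E" "is_subobject C E s"
      and s_iff: "\<And>Z a b. a \<in> hom C Z Y \<Longrightarrow> b \<in> hom C Z Y \<Longrightarrow> mem (s \<cdot> a) b \<longleftrightarrow> a = b"
    using singleton[OF E Y] by blast
  obtain d where d: "d \<in> hom C (Dom C m) P" "p \<cdot> d = m" "q \<cdot> d = f"
    using product_pair[OF P m f] by blast
  obtain c where c: "c \<in> hom C (Dom C n) P" "p \<cdot> c = n" "q \<cdot> c = g"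
    using product_pair[OF P n g] by blast
  have graph: "is_subobject C P k"
    if k: "k \<in> hom C K P" and l: "is_subobject C B l" "K = Dom C l" "p \<cdot> k = l" for k K l
  proof (rule is_subobjectI[OF k])
    fix X a b assume a: "a \<in> hom C X K" and b: "b \<in> hom C X K" and "k \<cdot> a = k \<cdot> b"
    then have "l \<cdot> a = l \<cdot> b"
      using comp_assoc[OF a k p] comp_assoc[OF b k p] l by simp
    then show "a = b"
      using mono_cancel[OF is_subobjectD(2,1)[OF l(1)]] a b l(2) by metis
  qed
  let ?imp = "\<lambda>l k w. \<forall>Y. \<forall>y \<in> hom C Y (Dom C w). sub_le C (p \<cdot> (w \<cdot> y)) l \<longrightarrow> sub_le C (w \<cdot> y) k"
  have imp: "representable P (?imp l k)" if "is_subobject C B l" "is_subobject C P k" for l k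
    using representable_imp[OF representable_pullback[OF p representable_subobject[OF that(1)]]
        representable_subobject[OF that(2)]] .
  obtain e where e: "e \<in> hom C B E"
      and e_iff: "\<And>Z w. w \<in> hom C Z P \<Longrightarrow> mem (e \<cdot> (p \<cdot> w)) (q \<cdot> w) \<longleftrightarrow> ?imp m d w \<and> ?imp n c w"
    using power_object_comprehension[OF E P representable_and[OF
        imp[OF ms graph[OF d(1) ms refl d(2)]] imp[OF ns graph[OF c(1) ns refl c(2)]]]] by blast
  \<comment> \<open>The condition attached to the other subobject holds vacuously: a stage lying in
    both subobjects is initial, and initial stages lie in every subobject.\<close>
  have disjoint: "?imp l k (k' \<cdot> z)"
    if z: "z \<in> hom C Z (Dom C l')" and k: "k \<in> hom C K P" and k': "k' \<in> hom C (Dom C l') P" "p \<cdot> k' = l'"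
      and ll': "is_complement C B l l' \<or> is_complement C B l' l" for l k l' k' z Z K
  proof (intro allI ballI impI)
    fix X y assume "y \<in> hom C X (Dom C (k' \<cdot> z))" and le: "sub_le C (p \<cdot> (k' \<cdot> z \<cdot> y)) l"
    then have y: "y \<in> hom C X Z"
      using homD(2)[OF comp_hom[OF z k'(1)]] by simp
    have zy: "z \<cdot> y \<in> hom C X (Dom C l')"
      using comp_hom[OF y z] .
    have l': "l' \<in> hom C (Dom C l') B"
      using ll' complementD by blast
    have kzy: "k' \<cdot> z \<cdot> y = k' \<cdot> (z \<cdot> y)"
      using comp_assoc[OF y z k'(1)] .
    have "p \<cdot> (k' \<cdot> z \<cdot> y) = l' \<cdot> (z \<cdot> y)"
      using comp_assoc[OF zy k'(1) p] kzy k'(2) by simp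
    then have "is_initial C X"
      using le ll' complement_meet[of B l l', OF _ comp_hom[OF zy l']]
        complement_meet[of B l' l, OF _ comp_hom[OF zy l']] sub_le_comp_left[OF l' zy] by auto
    then show "sub_le C (k' \<cdot> z \<cdot> y) k"
      using initial_sub_le[OF _ _ k] comp_hom[OF zy k'(1)] kzy by simp
  qed
  have em: "e \<cdot> m = s \<cdot> f"
  proof (rule singleton_of_graph[OF E P e e_iff s(1) s_iff ms d])
    show "?imp n c (d \<cdot> z)" if "z \<in> hom C Z (Dom C m)" for Z z
      using disjoint[OF that c(1) d(1,2)] mn by blast
  qed
  have e_iff': "mem (e \<cdot> (p \<cdot> w)) (q \<cdot> w) \<longleftrightarrow> ?imp n c w \<and> ?imp m d w"
    if "w \<in> hom C Z P" for Z w
    using e_iff[OF that] by (simp only: conj_commute)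
  have en: "e \<cdot> n = s \<cdot> g"
  proof (rule singleton_of_graph[OF E P e e_iff' s(1) s_iff ns c])
    show "?imp m d (c \<cdot> z)" if "z \<in> hom C Z (Dom C n)" for Z z
      using disjoint[OF that d(1) c(1,2)] mn by blast
  qed
  \<comment> \<open>The values of \<open>e\<close> are singletons on \<open>m\<close> and on
    \<open>n\<close>, hence on all of \<open>B\<close>, since the locus where they are singletons is
    a subobject.\<close>
  obtain u where u: "is_subobject C B u" "u \<in> hom C (Dom C u) B"
      and u_iff: "\<And>X x. x \<in> hom C X B \<Longrightarrow> sub_le C x u \<longleftrightarrow> sub_le C (e \<cdot> x) s"
    using representableE[OF representable_pullback[OF e representable_subobject[OF s(2)]]] by blast
  have "sub_le C (Id C B) u"
    using complement_join[OF mn u(1)] u_iff[OF m] u_iff[OF n] em en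
      sub_le_comp_left[OF s(1) f] sub_le_comp_left[OF s(1) g] by simp
  then obtain h where h: "h \<in> hom C B Y" "s \<cdot> h = e"
    using u_iff[OF id_hom[OF B]] id_right[OF e] sub_le_iff[OF e] homD(2)[OF s(1)] by auto
  have "h \<cdot> m = f"
    using mono_cancel[OF is_subobjectD(2)[OF s(2)] s(1) comp_hom[OF m h(1)] f]
      comp_assoc[OF m h(1) s(1)] h(2) em by simp
  moreover have "h \<cdot> n = g"
    using mono_cancel[OF is_subobjectD(2)[OF s(2)] s(1) comp_hom[OF n h(1)] g]
      comp_assoc[OF n h(1) s(1)] h(2) en by simp
  ultimately show ?thesis
    using that h(1) by blast
qed

text \<open>Existence is gluing. For uniqueness, the equalizer of two candidates contains
  \<open>m\<close> and \<open>n\<close>, so it is all of \<open>B\<close>.\<close>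

lemma complement_coproduct:
  assumes mn: "is_complement C B m n"
  shows "is_coproduct C (Dom C m) (Dom C n) B m n"
  unfolding is_coproduct_def
proof (intro conjI allI ballI complementD(3,4)[OF mn])
  note m = complementD(3)[OF mn] and n = complementD(4)[OF mn]
  have B: "B \<in> Obj C"
    using homD[OF m] by simp
  fix Y f g assume f: "f \<in> hom C (Dom C m) Y" and g: "g \<in> hom C (Dom C n) Y"
  obtain h where h: "h \<in> hom C B Y" "h \<cdot> m = f" "h \<cdot> n = g"
    using complement_glue[OF mn f g] by blast
  have "h' = h" if h': "h' \<in> hom C B Y" "h' \<cdot> m = f" "h' \<cdot> n = g" for h'
  proof -
    obtain u where u: "is_subobject C B u" "u \<in> hom C (Dom C u) B"
        and u_iff: "\<And>X x. x \<in> hom C X B \<Longrightarrow> sub_le C x u \<longleftrightarrow> h' \<cdot> x = h \<cdot> x"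
      using representableE[OF representable_eq[OF h'(1) h(1)]] by blast
    have "sub_le C (Id C B) u"
      using complement_join[OF mn u(1)] u_iff[OF m] u_iff[OF n] h h' by simp
    then show ?thesis
      using u_iff[OF id_hom[OF B]] id_right[OF h(1)] id_right[OF h'(1)] by simp
  qed
  then show "\<exists>!h. h \<in> hom C B Y \<and> h \<cdot> m = f \<and> h \<cdot> n = g"
    using h by blast
qed

section \<open>The object 2\<close>

text \<open>The union is the subobject \<open>\<forall>\<omega>. (x \<in> u \<longrightarrow> \<omega>) \<and> (x \<in> v \<longrightarrow> \<omega>) \<longrightarrow> \<omega>\<close>.\<close>

lemma union_exists:
  assumes u: "is_subobject C B u" and v: "is_subobject C B v"
  obtains w where "is_subobject C B w" "sub_le C u w" "sub_le C v w"
    "\<And>r. is_subobject C B r \<Longrightarrow> sub_le C u r \<Longrightarrow> sub_le C v r \<Longrightarrow> sub_le C w r"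
proof -
  note uh = is_subobjectD(1)[OF u] and vh = is_subobjectD(1)[OF v]
  have B: "B \<in> Obj C"
    using homD[OF uh] by simp
  obtain T \<Omega> t where cl: "is_subobject_classifier C T \<Omega> t"
    using classifier_exists by blast
  obtain P p q where P: "is_product C B \<Omega> P p q"
    using product_exists[OF B classifierD(4)[OF cl]] by blast
  note p = productD(1)[OF P] and q = productD(2)[OF P]
  let ?t = "\<lambda>x. sub_le C (q \<cdot> x) t"
  let ?A = "\<lambda>u x. \<forall>Y. \<forall>y \<in> hom C Y (Dom C x). sub_le C (p \<cdot> (x \<cdot> y)) u \<longrightarrow> ?t (x \<cdot> y)"
  let ?W = "\<lambda>x. \<forall>Y. \<forall>y \<in> hom C Y (Dom C x). ?A u (x \<cdot> y) \<and> ?A v (x \<cdot> y) \<longrightarrow> ?t (x \<cdot> y)"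
  have t: "representable P ?t"
    using representable_pullback[OF q representable_subobject[OF classifierD(3)[OF cl]]] .
  have A: "representable P (?A k)" if "is_subobject C B k" for k
    using representable_imp[OF representable_pullback[OF p representable_subobject[OF that]] t] .
  have W: "representable P ?W"
    using representable_imp[OF representable_and[OF A[OF u] A[OF v]] t] .
  obtain m where m: "is_subobject C B m" "m \<in> hom C (Dom C m) B"
      and m_iff: "\<And>X x. x \<in> hom C X B \<Longrightarrow> sub_le C x m \<longleftrightarrow>
        (\<forall>Z. \<forall>w \<in> hom C Z P. (\<exists>z \<in> hom C Z (Dom C x). p \<cdot> w = x \<cdot> z) \<longrightarrow> ?W w)"
    using representableE[OF representable_all[OF P W]] by blast
  \<comment> \<open>Stated for a general \<open>k\<close> to serve both \<open>u\<close> and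
    \<open>v\<close>: the premise of the formula contains the implication for \<open>k\<close>,
    which is evaluated at the identity.\<close>
  have le: "sub_le C k m"
    if k: "k \<in> hom C K B" and kA: "\<And>w. ?A u w \<and> ?A v w \<Longrightarrow> ?A k w" for k K
    unfolding m_iff[OF k] homD(2)[OF k]
  proof (intro allI ballI impI)
    fix Z w Y y assume w: "w \<in> hom C Z P" and "\<exists>z \<in> hom C Z K. p \<cdot> w = k \<cdot> z"
      and "y \<in> hom C Y (Dom C w)" and "?A u (w \<cdot> y) \<and> ?A v (w \<cdot> y)"
    then obtain z where z: "z \<in> hom C Z K" "p \<cdot> w = k \<cdot> z" and y: "y \<in> hom C Y Z"
        and Ak: "?A k (w \<cdot> y)"
      using homD(2)[OF w] kA by metis
    have wy: "w \<cdot> y \<in> hom C Y P"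
      using comp_hom[OF y w] .
    have "p \<cdot> (w \<cdot> y) = k \<cdot> (z \<cdot> y)"
      using comp_assoc[OF y w p] comp_assoc[OF y z(1) k] z(2) by simp
    then have "sub_le C (p \<cdot> (w \<cdot> y)) k"
      using sub_le_comp_left[OF k comp_hom[OF y z(1)]] by simp
    then show "?t (w \<cdot> y)"
      using Ak id_hom[OF homD(4)[OF wy]] homD(2)[OF wy] id_right[OF wy] by metis
  qed
  have "sub_le C m r" if r: "is_subobject C B r" "sub_le C u r" "sub_le C v r" for r
  proof -
    note rh = is_subobjectD(1)[OF r(1)]
    let ?M = "Dom C m"
    \<comment> \<open>The truth value to instantiate is membership in \<open>r\<close>: both
      implications then hold, since \<open>u\<close> and \<open>v\<close> lie below
      \<open>r\<close>.\<close>
    obtain \<chi> where \<chi>: "\<chi> \<in> hom C B \<Omega>"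
      and \<chi>_iff: "\<And>X x. x \<in> hom C X B \<Longrightarrow> sub_le C (\<chi> \<cdot> x) t \<longleftrightarrow> sub_le C x r"
      using classify[OF cl representable_subobject[OF r(1)]] by blast
    obtain w where w: "w \<in> hom C ?M P" "p \<cdot> w = m" "q \<cdot> w = \<chi> \<cdot> m"
      using product_pair[OF P m(2) comp_hom[OF m(2) \<chi>]] by blast
    have M: "Id C ?M \<in> hom C ?M ?M"
      using id_hom homD[OF m(2)] by blast
    have "?A k w" if k: "k \<in> hom C K B" "sub_le C k r" for k K
      unfolding homD(2)[OF w(1)]
    proof (intro allI ballI impI)
      fix Y y assume y: "y \<in> hom C Y ?M" and "sub_le C (p \<cdot> (w \<cdot> y)) k"
      moreover have eq: "p \<cdot> (w \<cdot> y) = m \<cdot> y" "q \<cdot> (w \<cdot> y) = \<chi> \<cdot> (m \<cdot> y)"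
        using comp_assoc[OF y w(1) p] comp_assoc[OF y w(1) q] comp_assoc[OF y m(2) \<chi>] w by auto
      ultimately show "?t (w \<cdot> y)"
        using sub_le_trans[OF comp_hom[OF y m(2)] k(1) rh _ k(2)] \<chi>_iff[OF comp_hom[OF y m(2)]]
        by simp
    qed
    then have "?A u w \<and> ?A v w"
      using uh vh r by blast
    moreover have "?W w"
      using m_iff[OF m(2)] sub_le_refl[OF m(2)] w(1,2) M id_right[OF m(2)] by metis
    ultimately have "?t w"
      using id_right[OF w(1)] M homD(2)[OF w(1)] by metis
    then show ?thesis
      using w(3) \<chi>_iff[OF m(2)] by simp
  qed
  then show ?thesis
    using that[OF m(1)] le[OF uh] le[OF vh] by blast
qed

lemma false_exists:
  assumes cl: "is_subobject_classifier C T \<Omega> t"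
  obtains f where "f \<in> hom C T \<Omega>"
    "\<And>X x. x \<in> hom C X T \<Longrightarrow> sub_le C (f \<cdot> x) t \<Longrightarrow> is_initial C X"
proof -
  have T: "T \<in> Obj C"
    using homD[OF classifierD(2)[OF cl]] by simp
  obtain f where "f \<in> hom C T \<Omega>"
      "\<And>X x. x \<in> hom C X T \<Longrightarrow> sub_le C (f \<cdot> x) t \<longleftrightarrow> is_initial C (Dom C x)"
    using classify[OF cl representable_initial[OF T]] by blast
  then show ?thesis
    using that homD(2) by metis
qed

text \<open>The sum 1 + 1 is carved out of \<Omega> as the union of the points true and false. These
  are disjoint, hence complementary inside their union, and \<open>complement_coproduct\<close>
  applies.\<close>

lemma two_exists: "\<exists>S. is_two C S"
proof -
  obtain T \<Omega> t where cl: "is_subobject_classifier C T \<Omega> t"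
    using classifier_exists by blast
  note T = classifierD(1)[OF cl] and t = classifierD(2)[OF cl] and ts = classifierD(3)[OF cl]
  obtain f where f: "f \<in> hom C T \<Omega>"
    and false: "\<And>X x. x \<in> hom C X T \<Longrightarrow> sub_le C (f \<cdot> x) t \<Longrightarrow> is_initial C X"
    using false_exists[OF cl] by blast
  note fs = point_is_subobject[OF T f]
  obtain w where w: "is_subobject C \<Omega> w" "sub_le C t w" "sub_le C f w"
    and w_least: "\<And>r. is_subobject C \<Omega> r \<Longrightarrow> sub_le C t r \<Longrightarrow> sub_le C f r \<Longrightarrow> sub_le C w r"
    using union_exists[OF ts fs] by blast
  note wh = is_subobjectD(1)[OF w(1)]
  let ?S = "Dom C w"
  have S: "?S \<in> Obj C"
    using homD[OF wh] by simp
  obtain i where i: "i \<in> hom C T ?S" "w \<cdot> i = t"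
    using w(2) sub_le_iff[OF t] by auto
  obtain j where j: "j \<in> hom C T ?S" "w \<cdot> j = f"
    using w(3) sub_le_iff[OF f] by auto
  have "is_complement C ?S i j"
  proof (rule is_complementI[OF point_is_subobject[OF T i(1)] point_is_subobject[OF T j(1)]])
    fix X x assume x: "x \<in> hom C X ?S" and "sub_le C x i" "sub_le C x j"
    then obtain a b where a: "a \<in> hom C X T" "i \<cdot> a = x" and b: "b \<in> hom C X T" "j \<cdot> b = x"
      using sub_le_iff[OF x] homD(2)[OF i(1)] homD(2)[OF j(1)] by auto
    have "f \<cdot> b = t \<cdot> a"
      using comp_assoc[OF a(1) i(1) wh] comp_assoc[OF b(1) j(1) wh] a b i j by simp
    then show "is_initial C X"
      using false[OF b(1)] sub_le_comp_left[OF t a(1)] by simp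
  next
    fix u assume u: "is_subobject C ?S u" "sub_le C i u" "sub_le C j u"
    note uh = is_subobjectD(1)[OF u(1)]
    note wu = comp_hom[OF uh wh]
    have le: "sub_le C (w \<cdot> k) (w \<cdot> u)" if k: "k \<in> hom C T ?S" "sub_le C k u" for k
    proof -
      obtain l where l: "l \<in> hom C T (Dom C u)" "u \<cdot> l = k"
        using k sub_le_iff[OF k(1)] by auto
      then show ?thesis
        using sub_le_comp_left[OF wu l(1)] comp_assoc[OF l(1) uh wh] by simp
    qed
    \<comment> \<open>Pushed forward along \<open>w\<close>, the subobject \<open>u\<close> still
      contains both points, so minimality of the union forces it to be everything.\<close>
    have "sub_le C w (w \<cdot> u)"
      using w_least[OF subobject_comp[OF w(1) u(1)]] le[OF i(1) u(2)] le[OF j(1) u(3)] i j by simp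
    then obtain k where k: "k \<in> hom C ?S (Dom C u)" "w \<cdot> u \<cdot> k = w"
      using sub_le_iff[OF wh] homD(2)[OF wu] by auto
    have "w \<cdot> (u \<cdot> k) = w \<cdot> Id C ?S"
      using comp_assoc[OF k(1) uh wh] k(2) id_right[OF wh] by simp
    then have "u \<cdot> k = Id C ?S"
      using mono_cancel[OF is_subobjectD(2)[OF w(1)] wh comp_hom[OF k(1) uh] id_hom[OF S]] by simp
    then show "sub_le C (Id C ?S) u"
      using sub_le_comp_left[OF uh k(1)] by simp
  qed
  then have "is_coproduct C T T ?S i j"
    using complement_coproduct homD(2)[OF i(1)] homD(2)[OF j(1)] by metis
  then show ?thesis
    using T unfolding is_two_def by blast
qed

text \<open>The copairing of true and false sends the two coprojections to points of \<Omega> that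
  agree only at initial stages.\<close>

lemma two_disjoint:
  assumes U: "is_terminal C U" and S: "is_coproduct C U U S i j"
    and a: "a \<in> hom C X U" and b: "b \<in> hom C X U" and eq: "i \<cdot> a = j \<cdot> b"
  shows "is_initial C X"
proof -
  obtain T \<Omega> t where cl: "is_subobject_classifier C T \<Omega> t"
    using classifier_exists by blast
  note T = classifierD(1)[OF cl] and t = classifierD(2)[OF cl]
  obtain f where f: "f \<in> hom C T \<Omega>"
    and false: "\<And>X x. x \<in> hom C X T \<Longrightarrow> sub_le C (f \<cdot> x) t \<Longrightarrow> is_initial C X"
    using false_exists[OF cl] by blast
  have i: "i \<in> hom C U S" and j: "j \<in> hom C U S"
    using S by (auto simp: is_coproduct_def)
  \<comment> \<open>The arrow \<open>c\<close> compares two choices of terminal object, that of the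
    coproduct and that of the classifier.\<close>
  obtain c where c: "c \<in> hom C U T"
    using is_terminalD[OF T homD(4)[OF i]] by blast
  obtain k where k: "k \<in> hom C S \<Omega>" "k \<cdot> i = t \<cdot> c" "k \<cdot> j = f \<cdot> c"
    using S comp_hom[OF c t] comp_hom[OF c f] unfolding is_coproduct_def by blast
  have "f \<cdot> (c \<cdot> b) = t \<cdot> (c \<cdot> a)"
    using comp_assoc[OF a i k(1)] comp_assoc[OF b j k(1)] comp_assoc[OF a c t] comp_assoc[OF b c f]
      eq k by simp
  then show ?thesis
    using false[OF comp_hom[OF b c]] sub_le_comp_left[OF t comp_hom[OF a c]] by simp
qed

text \<open>For the join, a subobject containing both coprojections receives an arrow from
  \<open>S\<close> by the universal property, and this arrow splits it.\<close>

lemma two_complement: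
  assumes U: "is_terminal C U" and S: "is_coproduct C U U S i j"
  shows "is_complement C S i j"
proof -
  have i: "i \<in> hom C U S" and j: "j \<in> hom C U S"
    using S by (auto simp: is_coproduct_def)
  show ?thesis
  proof (rule is_complementI[OF point_is_subobject[OF U i] point_is_subobject[OF U j]])
    fix X x assume x: "x \<in> hom C X S" "sub_le C x i" "sub_le C x j"
    then show "is_initial C X"
      using sub_le_iff[OF x(1)] homD(2)[OF i] homD(2)[OF j] two_disjoint[OF U S] by metis
  next
    fix u assume u: "is_subobject C S u" and "sub_le C i u" "sub_le C j u"
    note uh = is_subobjectD(1)[OF u]
    obtain a b where a: "a \<in> hom C U (Dom C u)" "u \<cdot> a = i" and b: "b \<in> hom C U (Dom C u)" "u \<cdot> b = j"
      using sub_le_iff[OF i] sub_le_iff[OF j] \<open>sub_le C i u\<close> \<open>sub_le C j u\<close> by auto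
    obtain k where k: "k \<in> hom C S (Dom C u)" "k \<cdot> i = a" "k \<cdot> j = b"
      using S a(1) b(1) unfolding is_coproduct_def by blast
    have "\<exists>!h. h \<in> hom C S S \<and> h \<cdot> i = i \<and> h \<cdot> j = j"
      using S i j unfolding is_coproduct_def by blast
    moreover have "u \<cdot> k \<in> hom C S S" "u \<cdot> k \<cdot> i = i" "u \<cdot> k \<cdot> j = j"
      using comp_hom[OF k(1) uh] comp_assoc[OF i k(1) uh] comp_assoc[OF j k(1) uh] k a b by auto
    moreover have "Id C S \<in> hom C S S" "Id C S \<cdot> i = i" "Id C S \<cdot> j = j"
      using id_hom[OF homD(5)[OF i]] id_left[OF i] id_left[OF j] by auto
    ultimately have "u \<cdot> k = Id C S"
      by blast
    then show "sub_le C (Id C S) u"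
      using sub_le_comp_left[OF uh k(1)] by simp
  qed
qed

section \<open>Decidable objects\<close>

lemma is_decidableD:
  assumes "is_decidable C D"
  obtains P p q d n where "is_product C D D P p q" "d \<in> hom C D P" "p \<cdot> d = Id C D" "q \<cdot> d = Id C D"
    "is_complement C P d n"
proof -
  obtain P p q d where d: "is_product C D D P p q" "d \<in> hom C D P" "p \<cdot> d = Id C D" "q \<cdot> d = Id C D"
    and "is_complemented C d"
    using assms unfolding is_decidable_def by blast
  then show ?thesis
    using that[OF d] homD(3)[OF d(2)] unfolding is_complemented_def by blast
qed

lemma is_decidableI:
  assumes "is_product C D D P p q" "d \<in> hom C D P" "p \<cdot> d = Id C D" "q \<cdot> d = Id C D"
    "is_complement C P d n"
  shows "is_decidable C D"
  using assms homD(3)[OF assms(2)] unfolding is_decidable_def is_complemented_def by blast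

text \<open>Excluded middle for equality, with the negation of equality as complement
  \<open>n\<close>. Each coordinate is split into the cases \<open>i\<close> and \<open>j\<close>;
  equal cases lie on the diagonal, and different ones lie in \<open>n\<close> by
  disjointness.\<close>

lemma two_decidable:
  assumes "is_two C S"
  shows "is_decidable C S"
proof -
  obtain U i j where U: "is_terminal C U" and S: "is_coproduct C U U S i j"
    using assms unfolding is_two_def by blast
  have i: "i \<in> hom C U S" and j: "j \<in> hom C U S"
    using S by (auto simp: is_coproduct_def)
  note SO = homD(5)[OF i] and ij = two_complement[OF U S]
  obtain P p q where P: "is_product C S S P p q"
    using product_exists[OF SO SO] by blast
  note p = productD(1)[OF P] and q = productD(2)[OF P] and PO = productD(5)[OF P]
  obtain d where d: "d \<in> hom C S P" "p \<cdot> d = Id C S" "q \<cdot> d = Id C S"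
    using product_pair[OF P id_hom[OF SO] id_hom[OF SO]] by blast
  note ds = diagonal(1)[OF P d] and d_iff = diagonal(2)[OF P d]
  obtain n where n: "is_subobject C P n" "n \<in> hom C (Dom C n) P"
    and n_iff: "\<And>X x. x \<in> hom C X P \<Longrightarrow> sub_le C x n \<longleftrightarrow>
      (\<forall>Y. \<forall>y \<in> hom C Y (Dom C x). p \<cdot> (x \<cdot> y) = q \<cdot> (x \<cdot> y) \<longrightarrow> is_initial C Y)"
    using representableE[OF representable_not[OF representable_eq[OF p q] PO]] by blast
  have "is_complement C P d n"
  proof (rule is_complementI[OF ds n(1)])
    fix X x assume x: "x \<in> hom C X P" "sub_le C x d" "sub_le C x n"
    then show "is_initial C X"
      using d_iff[OF x(1)] n_iff[OF x(1)] id_hom[OF homD(4)[OF x(1)]] homD(2)[OF x(1)]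
        id_right[OF x(1)] by metis
  next
    fix u assume u: "is_subobject C P u" "sub_le C d u" "sub_le C n u"
    note uh = is_subobjectD(1)[OF u(1)]
    have cases: "sub_le C x u"
      if x: "x \<in> hom C X P" and k: "k \<in> {i, j}" "sub_le C (p \<cdot> x) k"
        and l: "l \<in> {i, j}" "sub_le C (q \<cdot> x) l" for X x k l
    proof -
      have px: "p \<cdot> x \<in> hom C X S" and qx: "q \<cdot> x \<in> hom C X S"
        using comp_hom x p q by auto
      have kl: "k \<in> hom C U S" "l \<in> hom C U S"
        using k l i j by auto
      obtain a where a: "a \<in> hom C X U" "k \<cdot> a = p \<cdot> x"
        using k(2) sub_le_iff[OF px] homD(2)[OF kl(1)] by auto
      obtain b where b: "b \<in> hom C X U" "l \<cdot> b = q \<cdot> x"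
        using l(2) sub_le_iff[OF qx] homD(2)[OF kl(2)] by auto
      show ?thesis
      proof (cases "k = l")
        case True
        then have "p \<cdot> x = q \<cdot> x"
          using terminal_unique[OF U a(1) b(1)] a b by simp
        then show ?thesis
          using sub_le_trans[OF x d(1) uh _ u(2)] d_iff[OF x] by simp
      next
        case False
        have "is_initial C Y" if y: "y \<in> hom C Y X" and "p \<cdot> (x \<cdot> y) = q \<cdot> (x \<cdot> y)" for Y y
        proof -
          have "k \<cdot> (a \<cdot> y) = l \<cdot> (b \<cdot> y)"
            using comp_assoc[OF y a(1) kl(1)] comp_assoc[OF y b(1) kl(2)] comp_assoc[OF y x p]
              comp_assoc[OF y x q] a b that(2) by simp
          then have "i \<cdot> (a \<cdot> y) = j \<cdot> (b \<cdot> y) \<or> i \<cdot> (b \<cdot> y) = j \<cdot> (a \<cdot> y)"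
            using False k(1) l(1) by auto
          then show ?thesis
            using two_disjoint[OF U S] comp_hom[OF y a(1)] comp_hom[OF y b(1)] by blast
        qed
        then have "sub_le C x n"
          using n_iff[OF x] homD(2)[OF x] by simp
        then show ?thesis
          using sub_le_trans[OF x n(2) uh _ u(3)] by simp
      qed
    qed
    \<comment> \<open>Here the second coordinate is split, with the case of the first one fixed; the
      first coordinate is split in the last line of this part.\<close>
    have step: "sub_le C x u" if x: "x \<in> hom C X P" and k: "k \<in> {i, j}" "sub_le C (p \<cdot> x) k" for X x k
    proof (rule complement_cover[OF ij comp_hom[OF x q] representable_subobject[OF u(1)] x])
      have kh: "k \<in> hom C U S"
        using k i j by auto
      have le: "sub_le C (x \<cdot> y) u"
        if y: "y \<in> hom C Y X" and l: "l \<in> {i, j}" "sub_le C (q \<cdot> x \<cdot> y) l" for Y y l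
        using cases[OF comp_hom[OF y x] k(1) _ l(1)] l(2) comp_assoc[OF y x p] comp_assoc[OF y x q]
          sub_le_comp[OF kh comp_hom[OF x p] k(2) y] by simp
      show "sub_le C (x \<cdot> y) u" if "y \<in> hom C Y X" "sub_le C (q \<cdot> x \<cdot> y) i" for Y y
        using le[OF that(1) _ that(2)] by simp
      show "sub_le C (x \<cdot> y) u" if "y \<in> hom C Y X" "sub_le C (q \<cdot> x \<cdot> y) j" for Y y
        using le[OF that(1) _ that(2)] by simp
    qed
    show "sub_le C (Id C P) u"
      by (rule complement_cover_subobject[OF ij p u(1)]) (use step in auto)
  qed
  then show ?thesis
    using is_decidableI[OF P d] by blast
qed

text \<open>As \<open>m\<close> is monic, the diagonal of \<open>Dom C m\<close> is the preimage of
  the diagonal of \<open>D\<close> under \<open>x\<close>, the product of \<open>m\<close> with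
  itself, and complements pull back.\<close>

lemma subobject_decidable:
  assumes D: "is_decidable C D" and m: "is_subobject C D m"
  shows "is_decidable C (Dom C m)"
proof -
  obtain P p q d n where P: "is_product C D D P p q"
    and d: "d \<in> hom C D P" "p \<cdot> d = Id C D" "q \<cdot> d = Id C D" and dn: "is_complement C P d n"
    using is_decidableD[OF D] by blast
  note p = productD(1)[OF P] and q = productD(2)[OF P] and mh = is_subobjectD(1)[OF m]
  let ?I = "Dom C m"
  have I: "?I \<in> Obj C"
    using homD[OF mh] by simp
  obtain P' p' q' where P': "is_product C ?I ?I P' p' q'"
    using product_exists[OF I I] by blast
  note p' = productD(1)[OF P'] and q' = productD(2)[OF P']
  obtain d' where d': "d' \<in> hom C ?I P'" "p' \<cdot> d' = Id C ?I" "q' \<cdot> d' = Id C ?I"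
    using product_pair[OF P' id_hom[OF I] id_hom[OF I]] by blast
  obtain x where x: "x \<in> hom C P' P" "p \<cdot> x = m \<cdot> p'" "q \<cdot> x = m \<cdot> q'"
    using product_pair[OF P comp_hom[OF p' mh] comp_hom[OF q' mh]] by blast
  obtain n' where n': "is_subobject C P' n'" "n' \<in> hom C (Dom C n') P'"
    and n'_iff: "\<And>Y y. y \<in> hom C Y P' \<Longrightarrow> sub_le C y n' \<longleftrightarrow> sub_le C (x \<cdot> y) n"
    using representableE[OF representable_pullback[OF x(1)
      representable_subobject[OF complementD(2)[OF dn]]]] by blast
  have "is_complement C P' d' n'"
  proof (rule complement_pullback[OF dn x(1) diagonal(1)[OF P' d'] n'(1) _ n'_iff])
    fix Y y assume y: "y \<in> hom C Y P'"
    have eqs: "p \<cdot> (x \<cdot> y) = m \<cdot> (p' \<cdot> y)" "q \<cdot> (x \<cdot> y) = m \<cdot> (q' \<cdot> y)"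
      using comp_assoc[OF y x(1) p] comp_assoc[OF y x(1) q] comp_assoc[OF y p' mh]
        comp_assoc[OF y q' mh] x by auto
    have "p' \<cdot> y = q' \<cdot> y \<longleftrightarrow> m \<cdot> (p' \<cdot> y) = m \<cdot> (q' \<cdot> y)"
      using mono_cancel[OF is_subobjectD(2)[OF m] mh comp_hom[OF y p'] comp_hom[OF y q']] by auto
    then show "sub_le C y d' \<longleftrightarrow> sub_le C (x \<cdot> y) d"
      using diagonal(2)[OF P' d' y] diagonal(2)[OF P d comp_hom[OF y x(1)]] eqs by simp
  qed
  then show ?thesis
    using is_decidableI[OF P' d'] by blast
qed

section \<open>The reflection and the uniqueness of decidable quotients\<close>

text \<open>The adjunction as a universal arrow: \<eta> is the image of the identity under \<phi>,
  and naturality shows that \<phi> is composition with \<eta>, so its bijectivity is unique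
  factorization.\<close>

lemma decidable_reflection:
  assumes "reflective_in (Dec C) C" and X: "X \<in> Obj C"
  obtains D \<eta> where "is_decidable C D" "\<eta> \<in> hom C X D"
    "\<And>Y f. is_decidable C Y \<Longrightarrow> f \<in> hom C X Y \<Longrightarrow> \<exists>!g. g \<in> hom C D Y \<and> g \<cdot> \<eta> = f"
proof -
  obtain L\<^sub>0 L\<^sub>1 \<phi> where "adjunction C (Dec C) L\<^sub>0 L\<^sub>1 (\<lambda>Y. Y) (\<lambda>g. g) \<phi>"
    using assms(1) unfolding reflective_in_def by blast
  then interpret A: adjunction C "Dec C" L\<^sub>0 L\<^sub>1 "\<lambda>Y. Y" "\<lambda>g. g" \<phi> .
  have hom_Dec: "hom (Dec C) A B = (if is_decidable C A \<and> is_decidable C B then hom C A B else {})"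
    for A B
    by (auto simp: Dec_def full_subcategory_def hom_def)
  have Obj_Dec: "A \<in> Obj (Dec C) \<longleftrightarrow> A \<in> Obj C \<and> is_decidable C A" for A
    by (auto simp: Dec_def full_subcategory_def)
  have Dec_simps: "Comp (Dec C) = Comp C" "Id (Dec C) = Id C"
    by (simp_all add: Dec_def full_subcategory_def)
  let ?D = "L\<^sub>0 X"
  let ?\<eta> = "\<phi> X ?D (Id C ?D)"
  have D: "?D \<in> Obj C" "is_decidable C ?D"
    using A.L.map_obj[OF X] Obj_Dec by auto
  have Id_D: "Id C ?D \<in> hom (Dec C) ?D ?D"
    using id_hom[OF D(1)] D(2) hom_Dec by simp
  have bij: "bij_betw (\<phi> X Y) (hom C ?D Y) (hom C X Y)" if "is_decidable C Y" "Y \<in> Obj C" for Y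
    using A.hom_bij[OF X, of Y] that D Obj_Dec hom_Dec by simp
  have \<eta>: "?\<eta> \<in> hom C X ?D"
    using bij[OF D(2,1)] id_hom[OF D(1)] by (auto dest: bij_betwE)
  have \<phi>: "\<phi> X Y g = g \<cdot> ?\<eta>" if Y: "is_decidable C Y" and g: "g \<in> hom C ?D Y" for Y g
  proof -
    have gD: "g \<in> hom (Dec C) ?D Y"
      using g Y D hom_Dec by simp
    \<comment> \<open>Naturality at the identity of \<open>X\<close>, applied to
      \<open>Id C ?D\<close>, whose image under \<phi> is the unit.\<close>
    have "\<phi> X Y (g \<cdot> Id C ?D \<cdot> L\<^sub>1 (Id C X)) = g \<cdot> ?\<eta> \<cdot> Id C X"
      using A.hom_natural[OF id_hom[OF X] gD Id_D] by (simp add: Dec_simps)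
    then show ?thesis
      using A.L.map_id[OF X] id_right[OF g] id_right[OF comp_hom[OF \<eta> g]] by (simp add: Dec_simps)
  qed
  have "\<exists>!g. g \<in> hom C ?D Y \<and> g \<cdot> ?\<eta> = f" if Y: "is_decidable C Y" and f: "f \<in> hom C X Y" for Y f
  proof -
    note bijY = bij[OF Y homD(5)[OF f]]
    obtain g where "g \<in> hom C ?D Y" "\<phi> X Y g = f"
      using bij_betw_imp_surj_on[OF bijY] f by force
    then have "\<exists>!g. g \<in> hom C ?D Y \<and> \<phi> X Y g = f"
      using inj_onD[OF bij_betw_imp_inj_on[OF bijY]] by blast
    then show ?thesis
      using \<phi>[OF Y] by metis
  qed
  then show ?thesis
    using that[OF D(2) \<eta>] by blast
qed

text \<open>The equalizer of two arrows that agree on \<open>\<eta>\<close> is decidable, so \<open>\<eta>\<close> factors through it and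
  the reflection retracts \<open>D\<close> onto it.\<close>

lemma decidable_reflection_epi:
  assumes D: "is_decidable C D" and \<eta>: "\<eta> \<in> hom C X D"
    and univ: "\<And>Y f. is_decidable C Y \<Longrightarrow> f \<in> hom C X Y \<Longrightarrow> \<exists>!g. g \<in> hom C D Y \<and> g \<cdot> \<eta> = f"
  shows "is_epi C \<eta>"
proof -
  have DO: "D \<in> Obj C"
    using homD[OF \<eta>] by simp
  have "f = g" if f: "f \<in> hom C D Y" and g: "g \<in> hom C D Y" and eq: "f \<cdot> \<eta> = g \<cdot> \<eta>" for Y f g
  proof -
    obtain e where e: "is_subobject C D e" "e \<in> hom C (Dom C e) D"
        and e_iff: "\<And>X x. x \<in> hom C X D \<Longrightarrow> sub_le C x e \<longleftrightarrow> f \<cdot> x = g \<cdot> x"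
      using representableE[OF representable_eq[OF f g]] by blast
    obtain k where k: "k \<in> hom C X (Dom C e)" "e \<cdot> k = \<eta>"
      using e_iff[OF \<eta>] eq sub_le_iff[OF \<eta>] by auto
    obtain r where r: "r \<in> hom C D (Dom C e)" "r \<cdot> \<eta> = k"
      using univ[OF subobject_decidable[OF D e(1)] k(1)] by blast
    have "e \<cdot> r \<cdot> \<eta> = \<eta>"
      using comp_assoc[OF \<eta> r(1) e(2)] r(2) k(2) by simp
    then have "e \<cdot> r = Id C D"
      using univ[OF D \<eta>] comp_hom[OF r(1) e(2)] id_hom[OF DO] id_left[OF \<eta>] by blast
    then have "sub_le C (Id C D) e"
      using sub_le_comp_left[OF e(2) r(1)] by simp
    then show ?thesis
      using e_iff[OF id_hom[OF DO]] id_right[OF f] id_right[OF g] by simp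
  qed
  then show ?thesis
    using homD[OF \<eta>] by (auto simp: is_epi_def)
qed

text \<open>With \<open>a\<close> and \<open>b\<close> the coordinates of \<open>w\<close>, the
  locus where \<open>y\<close> equals \<open>b\<close> is complemented in \<open>D\<close>, and
  \<chi> is its two-valued characteristic arrow. The conclusion is conditional on initiality of
  \<open>T\<close> because a degenerate topos is allowed.\<close>

lemma decidable_points_separated:
  assumes P: "is_product C D D P p q"
    and d: "d \<in> hom C D P" "p \<cdot> d = Id C D" "q \<cdot> d = Id C D" and dn: "is_complement C P d n"
    and T: "is_terminal C T" and w: "w \<in> hom C T P" "sub_le C w n"
    and U: "is_terminal C U" and S: "is_coproduct C U U S i j"
  obtains \<chi> where "\<chi> \<in> hom C D S" "\<chi> \<cdot> (p \<cdot> w) = \<chi> \<cdot> (q \<cdot> w) \<Longrightarrow> is_initial C T"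
proof -
  note p = productD(1)[OF P] and q = productD(2)[OF P] and D = productD(3)[OF P]
  have i: "i \<in> hom C U S" and j: "j \<in> hom C U S"
    using S by (auto simp: is_coproduct_def)
  define a b where "a = p \<cdot> w" and "b = q \<cdot> w"
  have a: "a \<in> hom C T D" and b: "b \<in> hom C T D"
    using comp_hom[OF w(1)] p q by (auto simp: a_def b_def)
  obtain c where c: "c \<in> hom C D T"
    using is_terminalD[OF T D] by blast
  \<comment> \<open>The arrow \<open>x\<close> sends \<open>y\<close> to the pair
    \<open>(y, b)\<close>, which is on the diagonal exactly where \<open>y\<close> is
    \<open>b\<close>.\<close>
  obtain x where x: "x \<in> hom C D P" "p \<cdot> x = Id C D" "q \<cdot> x = b \<cdot> c"
    using product_pair[OF P id_hom[OF D] comp_hom[OF c b]] by blast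
  have px: "p \<cdot> (x \<cdot> z) = z" and qx: "q \<cdot> (x \<cdot> z) = b" if z: "z \<in> hom C T D" for z
  proof -
    have "c \<cdot> z = Id C T"
      using terminal_unique[OF T comp_hom[OF z c] id_hom[OF homD(4)[OF z]]] .
    then show "p \<cdot> (x \<cdot> z) = z" "q \<cdot> (x \<cdot> z) = b"
      using comp_assoc[OF z x(1) p] comp_assoc[OF z x(1) q] comp_assoc[OF z c b] x
        id_left[OF z] id_right[OF b] by auto
  qed
  obtain m' where m': "is_subobject C D m'" "m' \<in> hom C (Dom C m') D"
    and m'_iff: "\<And>Y y. y \<in> hom C Y D \<Longrightarrow> sub_le C y m' \<longleftrightarrow> sub_le C (x \<cdot> y) d"
    using representableE[OF representable_pullback[OF x(1)
      representable_subobject[OF complementD(1)[OF dn]]]] by blast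
  obtain n' where n': "is_subobject C D n'" "n' \<in> hom C (Dom C n') D"
    and n'_iff: "\<And>Y y. y \<in> hom C Y D \<Longrightarrow> sub_le C y n' \<longleftrightarrow> sub_le C (x \<cdot> y) n"
    using representableE[OF representable_pullback[OF x(1)
      representable_subobject[OF complementD(2)[OF dn]]]] by blast
  have compl: "is_complement C D m' n'"
    using complement_pullback[OF dn x(1) m'(1) n'(1) m'_iff n'_iff] .
  obtain u where u: "u \<in> hom C (Dom C m') U"
    using is_terminalD[OF U homD(4)[OF m'(2)]] by blast
  obtain v where v: "v \<in> hom C (Dom C n') U"
    using is_terminalD[OF U homD(4)[OF n'(2)]] by blast
  obtain \<chi> where \<chi>: "\<chi> \<in> hom C D S" "\<chi> \<cdot> m' = i \<cdot> u" "\<chi> \<cdot> n' = j \<cdot> v"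
    using complement_glue[OF compl comp_hom[OF u i] comp_hom[OF v j]] by blast
  \<comment> \<open>At \<open>a\<close> this pair is \<open>w\<close>, which lies in
    \<open>n\<close>; at \<open>b\<close> it is diagonal. Thus \<chi> takes the value
    \<open>j\<close> at \<open>a\<close> and \<open>i\<close> at \<open>b\<close>.\<close>
  have "x \<cdot> a = w"
    using product_ext[OF P comp_hom[OF a x(1)] w(1)] px[OF a] qx[OF a] a_def b_def by simp
  then obtain k where k: "k \<in> hom C T (Dom C n')" "n' \<cdot> k = a"
    using n'_iff[OF a] w(2) sub_le_iff[OF a] by auto
  have "sub_le C b m'"
    using m'_iff[OF b] diagonal(2)[OF P d comp_hom[OF b x(1)]] px[OF b] qx[OF b] by simp
  then obtain l where l: "l \<in> hom C T (Dom C m')" "m' \<cdot> l = b"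
    using sub_le_iff[OF b] by auto
  have "\<chi> \<cdot> a = j \<cdot> (v \<cdot> k)" "\<chi> \<cdot> b = i \<cdot> (u \<cdot> l)"
    using comp_assoc[OF k(1) n'(2) \<chi>(1)] comp_assoc[OF k(1) v j] comp_assoc[OF l(1) m'(2) \<chi>(1)]
      comp_assoc[OF l(1) u i] k l \<chi> by auto
  then have "\<chi> \<cdot> a = \<chi> \<cdot> b \<Longrightarrow> is_initial C T"
    using two_disjoint[OF U S comp_hom[OF l(1) u] comp_hom[OF k(1) v]] by simp
  then show ?thesis
    using that \<chi>(1) a_def b_def by blast
qed

text \<open>Decidability of \<open>D\<close> splits \<open>X\<close> into stages where the pair
  \<open>w = (f, g)\<close> is diagonal and stages where it is off the diagonal. The latter turn out
  to be initial, so \<open>f\<close> and \<open>g\<close> agree there as well.\<close>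

lemma mono_if_two_valued_factor:
  assumes NS: "NS C" and D: "is_decidable C D" and h: "h \<in> hom C D D'"
    and factor: "\<And>S \<chi>. is_two C S \<Longrightarrow> \<chi> \<in> hom C D S \<Longrightarrow> \<exists>g \<in> hom C D' S. g \<cdot> h = \<chi>"
  shows "is_mono C h"
proof (rule is_monoI[OF h])
  obtain P p q d n where P: "is_product C D D P p q"
    and d: "d \<in> hom C D P" "p \<cdot> d = Id C D" "q \<cdot> d = Id C D" and dn: "is_complement C P d n"
    using is_decidableD[OF D] by blast
  note p = productD(1)[OF P] and q = productD(2)[OF P]
  obtain S U i j where S: "is_two C S" and U: "is_terminal C U" and ij: "is_coproduct C U U S i j"
    using two_exists unfolding is_two_def by blast
  fix X f g assume f: "f \<in> hom C X D" and g: "g \<in> hom C X D" and eq: "h \<cdot> f = h \<cdot> g"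
  have X: "X \<in> Obj C"
    using homD[OF f] by simp
  obtain w where w: "w \<in> hom C X P" "p \<cdot> w = f" "q \<cdot> w = g"
    using product_pair[OF P f g] by blast
  have off_diagonal: "is_initial C Y" if y: "y \<in> hom C Y X" and n: "sub_le C (w \<cdot> y) n" for Y y
  proof (rule ccontr)
    assume Y: "\<not> is_initial C Y"
    then obtain T z where T: "is_terminal C T" and z: "z \<in> hom C T Y"
      using NS homD(4)[OF y] unfolding NS_def by blast
    have yz: "y \<cdot> z \<in> hom C T X" and wyz: "w \<cdot> (y \<cdot> z) \<in> hom C T P"
      using comp_hom z y w(1) by blast+
    have "sub_le C (w \<cdot> (y \<cdot> z)) n"
      using sub_le_comp[OF complementD(4)[OF dn] comp_hom[OF y w(1)] n z] comp_assoc[OF z y w(1)]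
      by simp
    then obtain \<chi> where \<chi>: "\<chi> \<in> hom C D S"
        and sep: "\<chi> \<cdot> (p \<cdot> (w \<cdot> (y \<cdot> z))) = \<chi> \<cdot> (q \<cdot> (w \<cdot> (y \<cdot> z))) \<Longrightarrow> is_initial C T"
      using decidable_points_separated[OF P d dn T wyz _ U ij] by blast
    obtain g' where g': "g' \<in> hom C D' S" "g' \<cdot> h = \<chi>"
      using factor[OF S \<chi>] by blast
    have "\<chi> \<cdot> f = \<chi> \<cdot> g"
      using comp_assoc[OF f h g'(1)] comp_assoc[OF g h g'(1)] eq g'(2) by simp
    then have "\<chi> \<cdot> (f \<cdot> (y \<cdot> z)) = \<chi> \<cdot> (g \<cdot> (y \<cdot> z))"
      using comp_assoc[OF yz f \<chi>] comp_assoc[OF yz g \<chi>] by simp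
    then have "is_initial C T"
      using sep comp_assoc[OF yz w(1) p] comp_assoc[OF yz w(1) q] w by simp
    \<comment> \<open>Initiality of \<open>T\<close> is not absurd by itself; the arrow from
      \<open>Y\<close> to \<open>T\<close> and strictness transfer it to \<open>Y\<close>, which is
      not initial.\<close>
    moreover obtain c where "c \<in> hom C Y T"
      using is_terminalD[OF T homD(4)[OF y]] by blast
    ultimately show False
      using Y initial_strict by blast
  qed
  \<comment> \<open>Equality of \<open>f\<close> and \<open>g\<close> is treated as a predicate on
    elements of \<open>X\<close> and evaluated at the identity, the generic element.\<close>
  have "f \<cdot> Id C X = g \<cdot> Id C X"
  proof (rule complement_cover[OF dn w(1) representable_eq[OF f g] id_hom[OF X]])
    fix Y y assume y: "y \<in> hom C Y X"
    have wy: "p \<cdot> (w \<cdot> y) = f \<cdot> y" "q \<cdot> (w \<cdot> y) = g \<cdot> y"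
      using comp_assoc[OF y w(1) p] comp_assoc[OF y w(1) q] w by auto
    show "f \<cdot> (Id C X \<cdot> y) = g \<cdot> (Id C X \<cdot> y)" if "sub_le C (w \<cdot> y) d"
      using that diagonal(2)[OF P d comp_hom[OF y w(1)]] wy id_left[OF y] by simp
    show "f \<cdot> (Id C X \<cdot> y) = g \<cdot> (Id C X \<cdot> y)" if "sub_le C (w \<cdot> y) n"
      using initial_arrows_eq[OF off_diagonal[OF y that] comp_hom[OF y f] comp_hom[OF y g]]
        id_left[OF y] by simp
  qed
  then show "f = g"
    using id_right[OF f] id_right[OF g] by simp
qed

text \<open>A topos is balanced: the characteristic arrow of \<open>m\<close> and the constant true
  agree on \<open>m\<close>. If \<open>m\<close> is epi they are equal, so \<open>m\<close> is
  everything.\<close>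

lemma mono_epi_iso:
  assumes m: "is_mono C m" and e: "is_epi C m" and mh: "m \<in> hom C M B"
  shows "is_iso C m"
proof -
  have ms: "is_subobject C B m"
    using m homD[OF mh] by (simp add: is_subobject_def)
  have B: "B \<in> Obj C"
    using homD[OF mh] by simp
  obtain T \<Omega> t where cl: "is_subobject_classifier C T \<Omega> t"
    using classifier_exists by blast
  obtain \<chi> where \<chi>: "\<chi> \<in> hom C B \<Omega>"
    and \<chi>_iff: "\<And>X x. x \<in> hom C X B \<Longrightarrow> sub_le C (\<chi> \<cdot> x) t \<longleftrightarrow> sub_le C x m"
    using classify[OF cl representable_subobject[OF ms]] by blast
  obtain \<tau> where \<tau>: "\<tau> \<in> hom C B \<Omega>"
    and \<tau>_iff: "\<And>X x. x \<in> hom C X B \<Longrightarrow> sub_le C (\<tau> \<cdot> x) t \<longleftrightarrow> True"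
    using classify[OF cl representable_True[OF B]] by blast
  have "\<chi> \<cdot> m = \<tau> \<cdot> m"
  proof (rule classifier_ext[OF cl comp_hom[OF mh \<chi>] comp_hom[OF mh \<tau>]])
    fix Y y assume y: "y \<in> hom C Y M"
    show "sub_le C (\<chi> \<cdot> m \<cdot> y) t \<longleftrightarrow> sub_le C (\<tau> \<cdot> m \<cdot> y) t"
      using comp_assoc[OF y mh \<chi>] comp_assoc[OF y mh \<tau>] \<chi>_iff[OF comp_hom[OF y mh]]
        \<tau>_iff[OF comp_hom[OF y mh]] sub_le_comp_left[OF mh y] by simp
  qed
  then have "\<chi> = \<tau>"
    using epi_cancel[OF e mh \<chi> \<tau>] by blast
  then have "sub_le C (Id C B) m"
    using \<chi>_iff[OF id_hom[OF B]] \<tau>_iff[OF id_hom[OF B]] by simp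
  then show ?thesis
    using mono_section_iso[OF ms] by blast
qed

text \<open>The comparison \<open>h\<close> exists because \<open>D'\<close> is a decidable target
  for the reflection. An arrow \<chi> from \<open>D\<close> to 2 factors through \<open>h\<close>,
  because \<open>\<chi> \<cdot> \<eta>\<close> factors through \<open>p'\<close> and \<eta> can be
  cancelled.\<close>

lemma DQO_if_reflective:
  assumes NS: "NS C" and refl: "reflective_in (Dec C) C"
  shows "DQO C"
  unfolding DQO_def
proof
  fix X assume X: "X \<in> Obj C"
  obtain D \<eta> where D: "is_decidable C D" and \<eta>: "\<eta> \<in> hom C X D"
    and univ: "\<And>Y f. is_decidable C Y \<Longrightarrow> f \<in> hom C X Y \<Longrightarrow> \<exists>!g. g \<in> hom C D Y \<and> g \<cdot> \<eta> = f"
    using decidable_reflection[OF refl X] by blast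
  have epi: "is_epi C \<eta>"
    using decidable_reflection_epi[OF D \<eta>] univ by blast
  have "is_decidable_quotient C X D \<eta>"
    using D \<eta> epi univ two_decidable unfolding is_decidable_quotient_def by blast
  moreover have "\<exists>h \<in> hom C D D'. is_iso C h \<and> h \<cdot> \<eta> = p'"
    if "is_decidable_quotient C X D' p'" for D' p'
  proof -
    have p': "p' \<in> hom C X D'" and epi': "is_epi C p'" and D': "is_decidable C D'"
      and two: "\<And>S f. is_two C S \<Longrightarrow> f \<in> hom C X S \<Longrightarrow> \<exists>!g. g \<in> hom C D' S \<and> g \<cdot> p' = f"
      using that unfolding is_decidable_quotient_def by blast+
    obtain h where h: "h \<in> hom C D D'" "h \<cdot> \<eta> = p'"
      using univ[OF D' p'] by blast
    have "is_mono C h"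
    proof (rule mono_if_two_valued_factor[OF NS D h(1)])
      fix S \<chi> assume S: "is_two C S" and \<chi>: "\<chi> \<in> hom C D S"
      obtain g where g: "g \<in> hom C D' S" "g \<cdot> p' = \<chi> \<cdot> \<eta>"
        using two[OF S comp_hom[OF \<eta> \<chi>]] by blast
      have "g \<cdot> h = \<chi>"
        using epi_cancel[OF epi \<eta> comp_hom[OF h(1) g(1)] \<chi>] comp_assoc[OF \<eta> h(1) g(1)] g h by simp
      then show "\<exists>g \<in> hom C D' S. g \<cdot> h = \<chi>"
        using g(1) by blast
    qed
    moreover have "is_epi C h"
    proof -
      have "f = g" if f: "f \<in> hom C D' Y" and g: "g \<in> hom C D' Y" and "f \<cdot> h = g \<cdot> h" for Y f g
        using epi_cancel[OF epi' p' f g] comp_assoc[OF \<eta> h(1) f] comp_assoc[OF \<eta> h(1) g] h that by simp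
      then show ?thesis
        using homD[OF h(1)] by (auto simp: is_epi_def)
    qed
    ultimately show ?thesis
      using mono_epi_iso[OF _ _ h(1)] h by blast
  qed
  ultimately show "\<exists>D p. is_decidable_quotient C X D p \<and>
      (\<forall>D' p'. is_decidable_quotient C X D' p' \<longrightarrow> (\<exists>h \<in> hom C D D'. is_iso C h \<and> h \<cdot> p = p'))"
    by blast
qed

end

theorem corollary2p3:
  fixes E :: "('o, 'a) cat"
  assumes "elementary_topos E"
    and "NS E"
    and "reflective_in (Dec E) E"
  shows "DQO E"
proof -
  interpret topos E
    using assms(1) by (simp add: topos_def)
  show ?thesis
    using DQO_if_reflective[OF assms(2,3)] .
qed

end
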